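(* Let $K$ be a totally real multiquadratic field with Galois group $G=\mathrm{Gal}(K/\mathbb{Q})$, and let $\varepsilon'\in\mathcal{O}_K^\times$ be a unit with $N_{K/\mathbb{Q}}(\varepsilon')=-1$. Then $\gcd\big([\mathcal{O}_K^\times:\mathbb{Z}[G]\cdot\varepsilon'],2\big)=1$, i.e. the index of the subgroup generated by the Galois conjugates of $\varepsilon'$ in $\mathcal{O}_K^\times$ is finite and odd.
   Context: A totally real multiquadratic field is $K=\mathbb{Q}(\sqrt{d_1},\ldots,\sqrt{d_m})$ with positive integers $d_i$ and $[K:\mathbb{Q}]=2^m$. $\mathbb{Z}[G]\cdot\varepsilon'$ denotes the multiplicative subgroup $\{\prod_{g\in G}g(\varepsilon')^{c_g}:c_g\in\mathbb{Z}\}$. *)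

theory Defs
  imports Complex_Main "HOL-Algebra.Algebra" "HOL-Algebra.Algebraic_Closure_Type"
    "HOL-Computational_Algebra.Polynomial"
begin

abbreviation real_ring :: "real ring" where
  "real_ring \<equiv> ring_of_type_algebra"

(* The number fields considered are totally real, so they are taken as subfields of the reals.
   The case m = 0, i.e. the field of rational numbers, is allowed. *)
definition totally_real_multiquadratic :: "real set \<Rightarrow> bool" where
  "totally_real_multiquadratic K \<longleftrightarrow>
     (\<exists>(m::nat) (d :: nat \<Rightarrow> nat).
        (\<forall>i\<in>{1..m}. d i > 0) \<and>
        K = generate_field real_ring ((\<lambda>i. sqrt (real (d i))) ` {1..m}) \<and>
        ring.dimension real_ring (2 ^ m) \<rat> K)"

(* Automorphisms are represented by functions that are undefined outside K, so that each
   automorphism of K occurs exactly once. *)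
definition galois_group :: "real set \<Rightarrow> (real \<Rightarrow> real) set" where
  "galois_group K =
     {g \<in> ring_iso (real_ring\<lparr>carrier := K\<rparr>) (real_ring\<lparr>carrier := K\<rparr>).
        g \<in> extensional K \<and> (\<forall>q\<in>\<rat>. g q = q)}"

(* The norm from K to the rational numbers, for K Galois over the rational numbers. *)
definition galois_norm :: "real set \<Rightarrow> real \<Rightarrow> real" where
  "galois_norm K x = (\<Prod>g\<in>galois_group K. g x)"

definition ring_of_integers :: "real set \<Rightarrow> real ring" where
  "ring_of_integers K = real_ring\<lparr>carrier := {x \<in> K. algebraic_int x}\<rparr>"

definition galois_span :: "real set \<Rightarrow> real \<Rightarrow> real set" where
  "galois_span K x =
     {(\<Prod>g\<in>galois_group K. g x powi c g) | c :: (real \<Rightarrow> real) \<Rightarrow> int. True}"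

end

(* A unit is written through its components for the characters of the Galois group, which is
   elementary abelian. Because the norm of \<epsilon> is -1, the components of \<epsilon> for the nontrivial
   characters have absolute value different from 1. Every unit can therefore be multiplied by
   conjugates of \<epsilon> until all its components, and hence all its conjugates, are bounded, and there
   are only finitely many such algebraic integers: the index is finite. Over the field with two
   elements, the sign vector of \<epsilon> is invertible in the group ring, so a product of conjugates of
   \<epsilon> which is totally positive has even exponents. Thus a unit whose square lies in the subgroup
   lies in the subgroup itself (note that -1 is the norm of \<epsilon>), the quotient has no element of
   order 2, and the index is odd. *)

theory Submission
  imports Defs "Jordan_Normal_Form.Char_Poly"
begin

section \<open>Algebraic integers form a ring\<close>

text \<open>Finiteness is obtained without a regulator. A component of a unit is again a unit of K,
  and every automorphism fixes or inverts it, so keeping the absolute values of all components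
  between 1 and a constant controls all conjugates at once. The price is the factor 2^m, where m is
  the number of square roots: passing to a component is a projection not divided by the group order,
  so repeating it gives a 2^m-th power, and the components recover only the 2^m-th power of the
  unit. Bounds survive taking roots, so this does no harm. The trivial character needs no
  correction, because its component is the norm. Automorphisms and characters are both coded as
  subsets of the index set of the square roots. The coding is faithful because degree 2^m makes the
  2^m products of square roots linearly independent over the rationals. Finiteness has to come
  before oddness: the absence of elements of order 2 gives an odd order only for a finite
  quotient.\<close>

definition int_span :: "'a::comm_ring_1 set \<Rightarrow> 'a set" where
  "int_span V = {(\<Sum>v\<in>V. of_int (c v) * v) | c :: 'a \<Rightarrow> int. True}"

lemma int_span_add: "x \<in> int_span V \<Longrightarrow> y \<in> int_span V \<Longrightarrow> x + y \<in> int_span V"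
proof -
  assume "x \<in> int_span V" "y \<in> int_span V"
  then obtain c c' :: "'a \<Rightarrow> int" where
    "x = (\<Sum>v\<in>V. of_int (c v) * v)" "y = (\<Sum>v\<in>V. of_int (c' v) * v)"
    by (auto simp: int_span_def)
  hence "x + y = (\<Sum>v\<in>V. of_int (c v + c' v) * v)"
    by (simp add: sum.distrib algebra_simps)
  thus ?thesis
    unfolding int_span_def by (intro CollectI exI[of _ "\<lambda>v. c v + c' v"]) simp
qed

lemma int_span_scale: "x \<in> int_span V \<Longrightarrow> of_int k * x \<in> int_span V"
proof -
  assume "x \<in> int_span V"
  then obtain c :: "'a \<Rightarrow> int" where "x = (\<Sum>v\<in>V. of_int (c v) * v)"
    by (auto simp: int_span_def)
  hence "of_int k * x = (\<Sum>v\<in>V. of_int (k * c v) * v)"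
    by (simp add: sum_distrib_left algebra_simps)
  thus ?thesis
    unfolding int_span_def by (intro CollectI exI[of _ "\<lambda>v. k * c v"]) simp
qed

lemma int_span_sum:
  fixes f :: "'b \<Rightarrow> 'a :: comm_ring_1"
  assumes "\<And>i. i \<in> I \<Longrightarrow> f i \<in> int_span V"
  shows "(\<Sum>i\<in>I. f i) \<in> int_span V"
proof -
  have "(0::'a) \<in> int_span V"
    unfolding int_span_def by (intro CollectI exI[of _ "\<lambda>v. 0"]) simp
  thus ?thesis
    using assms by (induction I rule: infinite_finite_induct) (auto intro: int_span_add)
qed

lemma int_span_base:
  assumes "finite V" "v \<in> V"
  shows "v \<in> int_span V"
proof -
  have "v = (\<Sum>w\<in>V. of_int (if w = v then 1 else 0) * w)"
    using assms by (simp add: if_distrib[of of_int] if_distrib[of "\<lambda>x. x * _"] cong: if_cong)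
  thus ?thesis
    unfolding int_span_def by (intro CollectI exI[of _ "\<lambda>w. if w = v then 1 else 0"]) simp
qed

lemma int_span_stable:
  assumes "\<And>v. v \<in> V \<Longrightarrow> x * v \<in> int_span V" "w \<in> int_span V"
  shows "x * w \<in> int_span V"
proof -
  from assms(2) obtain c :: "'a \<Rightarrow> int" where "w = (\<Sum>v\<in>V. of_int (c v) * v)"
    by (auto simp: int_span_def)
  hence "x * w = (\<Sum>v\<in>V. of_int (c v) * (x * v))"
    by (simp add: sum_distrib_left algebra_simps)
  thus ?thesis
    using assms(1) by (auto intro!: int_span_sum int_span_scale)
qed

text \<open>Multiplication by \<open>x\<close> is given on \<open>V\<close> by an integer matrix, and \<open>x\<close> is an eigenvalue of
  that matrix.\<close>

lemma algebraic_int_if_stable: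
  fixes x :: "'a :: field_char_0"
  assumes "finite V" "v0 \<in> V" "v0 \<noteq> 0"
    and stable: "\<And>v. v \<in> V \<Longrightarrow> x * v \<in> int_span V"
  shows "algebraic_int x"
proof -
  obtain vs where vs: "set vs = V" "distinct vs"
    using finite_distinct_list[OF assms(1)] by blast
  define n where "n = length vs"
  have "\<forall>v\<in>V. \<exists>c :: 'a \<Rightarrow> int. x * v = (\<Sum>w\<in>V. of_int (c w) * w)"
    using stable by (auto simp: int_span_def)
  then obtain c :: "'a \<Rightarrow> 'a \<Rightarrow> int"
    where c: "\<And>v. v \<in> V \<Longrightarrow> x * v = (\<Sum>w\<in>V. of_int (c v w) * w)"
    by metis
  define M where "M = mat n n (\<lambda>(i, j). c (vs ! i) (vs ! j))"
  have M: "M \<in> carrier_mat n n"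
    by (simp add: M_def)
  let ?M = "map_mat (of_int :: int \<Rightarrow> 'a) M"
  define w where "w = vec n (\<lambda>i. vs ! i)"
  have sum_V: "(\<Sum>v\<in>V. f v) = (\<Sum>i<n. f (vs ! i))" for f :: "'a \<Rightarrow> 'a"
    using sum.reindex_bij_betw[OF bij_betw_nth[OF vs(2) refl refl], of f] vs(1)
    by (simp add: n_def)
  have "?M *\<^sub>v w = x \<cdot>\<^sub>v w"
  proof (rule eq_vecI)
    fix i assume "i < dim_vec (x \<cdot>\<^sub>v w)"
    hence i: "i < n" by (simp add: w_def)
    hence "vs ! i \<in> V" using vs by (auto simp: n_def)
    thus "vec_index (?M *\<^sub>v w) i = vec_index (x \<cdot>\<^sub>v w) i"
      using i c[of "vs ! i"]
      by (simp add: M_def w_def scalar_prod_def sum_V lessThan_atLeast0)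
  qed (simp add: M_def w_def)
  moreover have "w \<noteq> 0\<^sub>v n"
  proof
    assume "w = 0\<^sub>v n"
    obtain i where "i < n" "vs ! i = v0"
      using assms(2) vs by (auto simp: in_set_conv_nth n_def)
    have "vec_index w i = 0"
      unfolding \<open>w = 0\<^sub>v n\<close> using \<open>i < n\<close> by simp
    moreover have "vec_index w i = v0"
      using \<open>i < n\<close> \<open>vs ! i = v0\<close> by (simp add: w_def)
    ultimately show False using assms(3) by simp
  qed
  ultimately have "eigenvalue ?M x"
    unfolding eigenvalue_def eigenvector_def
    using M by (intro exI[of _ w]) (auto simp: w_def M_def)
  hence "poly (char_poly ?M) x = 0"
    using eigenvalue_root_char_poly[of ?M n x] M by simp
  moreover have "char_poly ?M = map_poly of_int (char_poly M)"
    by (rule of_int_hom.char_poly_hom[OF M])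
  moreover have "lead_coeff (char_poly M) = 1"
    using degree_monic_char_poly[OF M] by simp
  ultimately show ?thesis
    unfolding algebraic_int_altdef_ipoly by auto
qed

text \<open>The monic equation solved for its top power. Positivity of \<open>n\<close> makes
  \<open>x ^ 0 = 1\<close> one of the lower powers, so that the finite family built from them
  contains a nonzero element.\<close>

lemma algebraic_int_power_bound:
  fixes x :: "'a :: field_char_0"
  assumes "algebraic_int x"
  obtains n and c :: "nat \<Rightarrow> int" where "n > 0" "x ^ n = (\<Sum>i<n. of_int (c i) * x ^ i)"
proof -
  obtain p where p: "poly (map_poly of_int p) x = 0" "lead_coeff p = 1"
    using assms by (auto simp: algebraic_int_altdef_ipoly)
  define n where "n = degree p"
  have 0: "(\<Sum>i\<le>n. of_int (coeff p i) * x ^ i) = 0"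
    using p(1) by (simp add: poly_altdef degree_map_poly coeff_map_poly n_def)
  have "n > 0"
  proof (rule ccontr)
    assume "\<not> n > 0"
    with 0 p(2) show False by (simp add: n_def)
  qed
  moreover have "x ^ n = (\<Sum>i<n. of_int (- coeff p i) * x ^ i)"
    using 0 p(2) by (simp add: n_def lessThan_Suc_atMost[symmetric] sum_negf eq_neg_iff_add_eq_0 add.commute)
  ultimately show ?thesis by (rule that)
qed

text \<open>The finitely many monomials \<open>x ^ i * y ^ j\<close> below the two degrees span a
  group that multiplication by \<open>x\<close> and by \<open>y\<close> maps into itself; the same
  then holds for the sum and the product.\<close>

lemma algebraic_int_add_mult:
  fixes x y :: "'a :: field_char_0"
  assumes "algebraic_int x" "algebraic_int y"
  shows "algebraic_int (x + y) \<and> algebraic_int (x * y)"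
proof -
  obtain n c where n: "n > 0" "x ^ n = (\<Sum>i<n. of_int (c i) * x ^ i)"
    by (rule algebraic_int_power_bound[OF assms(1)])
  obtain m d where m: "m > 0" "y ^ m = (\<Sum>i<m. of_int (d i) * y ^ i)"
    by (rule algebraic_int_power_bound[OF assms(2)])
  define V where "V = (\<lambda>(i, j). x ^ i * y ^ j) ` ({..<n} \<times> {..<m})"
  have fin: "finite V" by (simp add: V_def)
  have base: "x ^ i * y ^ j \<in> int_span V" if "i < n" "j < m" for i j
    by (rule int_span_base[OF fin]) (use that in \<open>auto simp: V_def\<close>)
  have x: "x * v \<in> int_span V" if "v \<in> V" for v
  proof -
    obtain i j where ij: "i < n" "j < m" "v = x ^ i * y ^ j"
      using \<open>v \<in> V\<close> by (auto simp: V_def)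
    show ?thesis
    proof (cases "Suc i < n")
      case True
      thus ?thesis using base[OF True ij(2)] by (simp add: ij mult.assoc)
    next
      case False
      \<comment> \<open>Here \<open>Suc i = n\<close>: the product leaves the family, and the monic
        equation brings it back into the span.\<close>
      hence "x * v = x ^ n * y ^ j"
        using ij by (metis Suc_lessI mult.assoc power_Suc)
      also have "\<dots> = (\<Sum>k<n. of_int (c k) * (x ^ k * y ^ j))"
        unfolding n(2) by (simp add: sum_distrib_right mult.assoc)
      finally show ?thesis
        using base ij by (auto intro!: int_span_sum int_span_scale)
    qed
  qed
  have y: "y * v \<in> int_span V" if "v \<in> V" for v
  proof -
    obtain i j where ij: "i < n" "j < m" "v = x ^ i * y ^ j"
      using \<open>v \<in> V\<close> by (auto simp: V_def)
    show ?thesis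
    proof (cases "Suc j < m")
      case True
      thus ?thesis using base[OF ij(1) True] by (simp add: ij mult_ac)
    next
      case False
      hence "y * v = x ^ i * y ^ m"
        using ij by (metis Suc_lessI mult.left_commute power_Suc)
      also have "\<dots> = (\<Sum>k<m. of_int (d k) * (x ^ i * y ^ k))"
        unfolding m(2) by (simp add: sum_distrib_left mult_ac)
      finally show ?thesis
        using base ij by (auto intro!: int_span_sum int_span_scale)
    qed
  qed
  have "1 \<in> V"
    unfolding V_def using n(1) m(1) by (intro image_eqI[of _ _ "(0, 0)"]) auto
  note crit = algebraic_int_if_stable[OF fin this one_neq_zero]
  have "(x + y) * v \<in> int_span V" if "v \<in> V" for v
    using int_span_add[OF x y] that by (simp add: distrib_right)
  moreover have "(x * y) * v \<in> int_span V" if "v \<in> V" for v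
    using int_span_stable[of V x, OF x y[OF that]] by (simp add: mult.assoc)
  ultimately show ?thesis
    using crit by blast
qed

lemmas algebraic_int_plus = algebraic_int_add_mult[THEN conjunct1]
lemmas algebraic_int_times = algebraic_int_add_mult[THEN conjunct2]

lemma algebraic_int_sum:
  fixes f :: "'b \<Rightarrow> 'a :: field_char_0"
  shows "(\<And>i. i \<in> I \<Longrightarrow> algebraic_int (f i)) \<Longrightarrow> algebraic_int (\<Sum>i\<in>I. f i)"
  by (induction I rule: infinite_finite_induct) (auto intro: algebraic_int_plus)

lemma algebraic_int_prod:
  fixes f :: "'b \<Rightarrow> 'a :: field_char_0"
  shows "(\<And>i. i \<in> I \<Longrightarrow> algebraic_int (f i)) \<Longrightarrow> algebraic_int (\<Prod>i\<in>I. f i)"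
  by (induction I rule: infinite_finite_induct)
     (auto intro: algebraic_int_times int_imp_algebraic_int)

section \<open>Products of integer powers and sign characters\<close>

lemma power_int_prod: "(\<Prod>i\<in>I. f i) powi k = (\<Prod>i\<in>I. (f i :: 'a :: field) powi k)"
  by (induction I rule: infinite_finite_induct) (auto simp: power_int_mult_distrib)

lemma power_int_sum:
  assumes "(x :: 'a :: field) \<noteq> 0"
  shows "x powi (\<Sum>i\<in>I. k i) = (\<Prod>i\<in>I. x powi k i)"
  using assms by (induction I rule: infinite_finite_induct) (auto simp: power_int_add)

text \<open>Division with remainder for logarithms: for \<open>b > 1\<close> every positive real can
  be moved into the interval from 1 to \<open>b\<close> by a power of \<open>b\<close>. The maximum
  treats bases above and below 1 alike.\<close>

lemma ex_power_int_normalize: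
  fixes a b :: real
  assumes "a > 0" "b > 0" "b \<noteq> 1"
  shows "\<exists>k. 1 \<le> a * b powi k \<and> a * b powi k \<le> max b (inverse b)"
proof -
  have *: "\<exists>k. 1 \<le> a * b powi k \<and> a * b powi k \<le> b" if "b > 1" for b
  proof -
    define k where "k = \<lfloor>log b a\<rfloor>"
    have "b powi (- k) = b powr (- of_int k)"
      using that powr_real_of_int'[of b "- k"] by simp
    hence "a * b powi (- k) = b powr (log b a - of_int k)"
      using that assms by (simp add: powr_diff powr_minus divide_inverse)
    moreover have "1 \<le> b powr (log b a - of_int k)"
      using that by (intro ge_one_powr_ge_zero) (auto simp: k_def)
    moreover have "b powr (log b a - of_int k) \<le> b powr 1"
      using that by (intro powr_mono) (auto simp: k_def, linarith)
    ultimately show ?thesis using that by (intro exI[of _ "- k"]) simp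
  qed
  show ?thesis
  proof (cases "b > 1")
    case True
    with *[OF this] show ?thesis by (auto simp: max_def)
  next
    case False
    hence "inverse b > 1" using assms by (simp add: one_less_inverse)
    from *[OF this] obtain k where "1 \<le> a * b powi (- k)" "a * b powi (- k) \<le> inverse b"
      by (auto simp: power_int_inverse power_int_minus)
    thus ?thesis by (intro exI[of _ "- k"]) auto
  qed
qed

text \<open>The sign is a homomorphism to a group of order 2, so only exponents at negative factors
  count, and only modulo 2. Positivity thus becomes a linear equation over the field with two
  elements, kept here as a parity of integers.\<close>

lemma prod_power_int_pos_iff:
  fixes f :: "'b \<Rightarrow> real"
  assumes "finite I" "\<And>i. i \<in> I \<Longrightarrow> f i \<noteq> 0"
  shows "0 < (\<Prod>i\<in>I. f i powi c i) \<longleftrightarrow> even (\<Sum>i\<in>I. c i * (if f i < 0 then 1 else 0))"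
  using assms
proof (induction I rule: finite_induct)
  case (insert i I)
  have nz: "(\<Prod>i\<in>I. f i powi c i) \<noteq> 0"
    using insert by simp
  have "0 < f i powi c i \<longleftrightarrow> even (c i) \<or> f i > 0"
  proof (cases "f i > 0")
    case False
    define g where "g = - f i"
    have "g > 0" using False insert.prems[of i] by (simp add: g_def)
    hence "g powi c i > 0" by simp
    moreover have "f i powi c i = (if even (c i) then g powi c i else - (g powi c i))"
      using power_int_minus_left[of g "c i"] by (simp add: g_def)
    ultimately show ?thesis using False by simp
  qed simp
  moreover have "f i \<noteq> 0"
    using insert by auto
  moreover have "0 < x * y \<longleftrightarrow> (0 < x \<longleftrightarrow> 0 < y)" if "x \<noteq> 0" "y \<noteq> 0" for x y :: real
    using that by (cases "0 < x"; cases "0 < y") (auto simp: zero_less_mult_iff)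
  ultimately show ?case
    using insert.IH insert.prems insert.hyps nz by (cases "f i > 0") simp_all
qed simp

text \<open>Subsets form a vector space over the field with two elements; this is its standard
  bilinear form, written multiplicatively. The values are integers because they serve as exponents
  of conjugates.\<close>

definition sg :: "'i set \<Rightarrow> 'i set \<Rightarrow> int" where
  "sg I J = (- 1) ^ card (I \<inter> J)"

lemma sg_empty [simp]: "sg {} J = 1" "sg I {} = 1"
  by (simp_all add: sg_def)

lemma sg_commute: "sg I J = sg J I"
  by (simp add: sg_def Int_commute)

lemma sg_cases: "sg I J = 1 \<or> sg I J = - 1"
  by (cases "even (card (I \<inter> J))") (auto simp: sg_def)

lemma sg_square [simp]: "sg I J * sg I J = 1"
  using sg_cases[of I J] by auto

text \<open>The cardinalities of \<open>I \<inter> J\<close> and \<open>H \<inter> J\<close> add up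
  to that of \<open>sym_diff I H \<inter> J\<close> plus twice the triple intersection, which the
  sign does not see.\<close>

lemma sg_sym_diff_left:
  assumes "finite I" "finite H"
  shows "sg (sym_diff I H) J = sg I J * sg H J"
proof -
  let ?X = "I \<inter> J" and ?Y = "H \<inter> J"
  have "card ?X = card (?X - ?Y) + card (?X \<inter> ?Y)"
    using assms card_Int_Diff[of ?X ?Y] by simp
  moreover have "card ?Y = card (?Y - ?X) + card (?X \<inter> ?Y)"
    using assms card_Int_Diff[of ?Y ?X] by (simp add: Int_commute)
  moreover have "card (sym_diff I H \<inter> J) = card (?X - ?Y) + card (?Y - ?X)"
  proof -
    have "sym_diff I H \<inter> J = (?X - ?Y) \<union> (?Y - ?X)" by auto
    moreover have "card ((?X - ?Y) \<union> (?Y - ?X)) = card (?X - ?Y) + card (?Y - ?X)"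
      using assms by (intro card_Un_disjoint) auto
    ultimately show ?thesis by simp
  qed
  ultimately have "card ?X + card ?Y = card (sym_diff I H \<inter> J) + 2 * card (?X \<inter> ?Y)"
    by simp
  hence "sg I J * sg H J = (- 1) ^ (card (sym_diff I H \<inter> J) + 2 * card (?X \<inter> ?Y))"
    by (simp add: sg_def flip: power_add)
  thus ?thesis by (simp add: power_add power_mult sg_def)
qed

lemma sg_sym_diff_right:
  assumes "finite J" "finite H"
  shows "sg I (sym_diff J H) = sg I J * sg I H"
  using sg_sym_diff_left[OF assms, of I] by (simp add: sg_commute)

lemma sg_singleton: "sg {i} J = (if i \<in> J then - 1 else 1)"
  by (simp add: sg_def)

lemma bij_betw_sym_diff: "D \<subseteq> A \<Longrightarrow> bij_betw (sym_diff D) (Pow A) (Pow A)"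
  by (rule bij_betw_byWitness[of _ "sym_diff D"]) auto

lemma sum_Pow_sym_diff: "D \<subseteq> A \<Longrightarrow> (\<Sum>J\<in>Pow A. f (sym_diff D J)) = (\<Sum>J\<in>Pow A. f J)"
  using sum.reindex_bij_betw[OF bij_betw_sym_diff[of D A], of f] by simp

lemma prod_Pow_sym_diff: "D \<subseteq> A \<Longrightarrow> (\<Prod>J\<in>Pow A. f (sym_diff D J)) = (\<Prod>J\<in>Pow A. f J)"
  using prod.reindex_bij_betw[OF bij_betw_sym_diff[of D A], of f] by simp

text \<open>Orthogonality of characters: for \<open>j\<close> in \<open>J\<close>, translating
  \<open>I\<close> by \<open>{j}\<close> reverses every sign, so the sum equals its own
  negative.\<close>

lemma sum_sg:
  assumes "finite A" "J \<subseteq> A"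
  shows "(\<Sum>I\<in>Pow A. sg I J) = (if J = {} then 2 ^ card A else 0)"
proof (cases "J = {}")
  case True
  thus ?thesis using assms by (simp add: card_Pow)
next
  case False
  then obtain j where j: "j \<in> J" by auto
  have "(\<Sum>I\<in>Pow A. sg I J) = (\<Sum>I\<in>Pow A. sg (sym_diff {j} I) J)"
    using j assms by (intro sum_Pow_sym_diff[symmetric]) auto
  also have "\<dots> = (\<Sum>I\<in>Pow A. - sg I J)"
    using j assms finite_subset[OF _ assms(1)]
    by (intro sum.cong) (simp_all only: sg_sym_diff_left sg_singleton Pow_iff finite.intros, simp)
  also have "\<dots> = - (\<Sum>I\<in>Pow A. sg I J)" by (rule sum_negf)
  finally show ?thesis using False by simp
qed

text \<open>Translation by a nonempty \<open>D\<close> has no fixed point, so equal terms come in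
  pairs; membership of one element of \<open>D\<close> selects one set of each pair.\<close>

lemma even_sum_Pow_involution:
  fixes f :: "'i set \<Rightarrow> int"
  assumes "finite A" "D \<subseteq> A" "D \<noteq> {}"
    and inv: "\<And>H. H \<subseteq> A \<Longrightarrow> f (sym_diff D H) = f H"
  shows "even (\<Sum>H\<in>Pow A. f H)"
proof -
  obtain i where i: "i \<in> D" using assms by auto
  let ?P = "{H\<in>Pow A. i \<in> H}" and ?N = "{H\<in>Pow A. i \<notin> H}"
  have bij: "bij_betw (sym_diff D) ?P ?N"
    by (rule bij_betw_byWitness[of _ "sym_diff D"]) (use i assms(2) in auto)
  have "(\<Sum>H\<in>Pow A. f H) = (\<Sum>H\<in>?P \<union> ?N. f H)"
    by (rule sum.cong) auto
  also have "\<dots> = (\<Sum>H\<in>?P. f H) + (\<Sum>H\<in>?N. f H)"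
    by (rule sum.union_disjoint) (use assms(1) in auto)
  also have "(\<Sum>H\<in>?N. f H) = (\<Sum>H\<in>?P. f (sym_diff D H))"
    by (rule sum.reindex_bij_betw[OF bij, symmetric])
  also have "\<dots> = (\<Sum>H\<in>?P. f H)"
    using inv by (intro sum.cong) auto
  finally show ?thesis by simp
qed

section \<open>Units of a totally real field with elementary abelian Galois group\<close>

text \<open>The subsets of \<open>A\<close> under symmetric difference serve as the Galois group, and again as its
  character group, via the pairing \<open>sg\<close>.\<close>

locale sign_galois_field =
  fixes A :: "'i set" and K :: "real set" and \<phi> :: "'i set \<Rightarrow> real \<Rightarrow> real"
  assumes finite_A: "finite A"
    and Rats_K: "\<rat> \<subseteq> K"
    and add_K: "\<And>x y. x \<in> K \<Longrightarrow> y \<in> K \<Longrightarrow> x + y \<in> K"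
    and mult_K: "\<And>x y. x \<in> K \<Longrightarrow> y \<in> K \<Longrightarrow> x * y \<in> K"
    and inverse_K: "\<And>x. x \<in> K \<Longrightarrow> inverse x \<in> K"
    and phi_K: "\<And>J x. J \<subseteq> A \<Longrightarrow> x \<in> K \<Longrightarrow> \<phi> J x \<in> K"
    and phi_add: "\<And>J x y. J \<subseteq> A \<Longrightarrow> x \<in> K \<Longrightarrow> y \<in> K \<Longrightarrow> \<phi> J (x + y) = \<phi> J x + \<phi> J y"
    and phi_mult: "\<And>J x y. J \<subseteq> A \<Longrightarrow> x \<in> K \<Longrightarrow> y \<in> K \<Longrightarrow> \<phi> J (x * y) = \<phi> J x * \<phi> J y"
    and phi_Rats: "\<And>J q. J \<subseteq> A \<Longrightarrow> q \<in> \<rat> \<Longrightarrow> \<phi> J q = q"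
    and phi_phi: "\<And>J H x. J \<subseteq> A \<Longrightarrow> H \<subseteq> A \<Longrightarrow> x \<in> K \<Longrightarrow> \<phi> J (\<phi> H x) = \<phi> (sym_diff J H) x"
    and phi_empty: "\<And>x. x \<in> K \<Longrightarrow> \<phi> {} x = x"
    and phi_fixed: "\<And>x. x \<in> K \<Longrightarrow> (\<And>J. J \<subseteq> A \<Longrightarrow> \<phi> J x = x) \<Longrightarrow> x \<in> \<rat>"
    and ex_integral_basis: "\<exists>B. finite B \<and> B \<subseteq> K \<and> (\<forall>b\<in>B. algebraic_int b) \<and>
      (\<forall>x\<in>K. \<exists>q. (\<forall>b. q b \<in> \<rat>) \<and> x = (\<Sum>b\<in>B. q b * b))"
begin

section \<open>Arithmetic in K, traces and norms\<close>

lemma const_K [simp]: "0 \<in> K" "1 \<in> K" "of_int k \<in> K"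
  using Rats_K by auto

lemma uminus_K: "x \<in> K \<Longrightarrow> - x \<in> K"
  using mult_K[of "of_int (- 1)" x] const_K(3)[of "- 1"] by simp

lemma diff_K: "x \<in> K \<Longrightarrow> y \<in> K \<Longrightarrow> x - y \<in> K"
  using add_K[of x "- y"] uminus_K[of y] by simp

lemma sum_K: "(\<And>i. i \<in> I \<Longrightarrow> f i \<in> K) \<Longrightarrow> (\<Sum>i\<in>I. f i) \<in> K"
  by (induction I rule: infinite_finite_induct) (auto intro: add_K)

lemma prod_K: "(\<And>i. i \<in> I \<Longrightarrow> f i \<in> K) \<Longrightarrow> (\<Prod>i\<in>I. f i) \<in> K"
  by (induction I rule: infinite_finite_induct) (auto intro: mult_K)

lemma power_K: "x \<in> K \<Longrightarrow> x ^ n \<in> K"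
  by (induction n) (auto intro: mult_K)

lemma powi_K: "x \<in> K \<Longrightarrow> x powi k \<in> K"
  by (auto simp: power_int_def intro: power_K inverse_K)

lemma phi_const [simp]: "J \<subseteq> A \<Longrightarrow> \<phi> J 0 = 0" "J \<subseteq> A \<Longrightarrow> \<phi> J 1 = 1"
  "J \<subseteq> A \<Longrightarrow> \<phi> J (of_int k) = of_int k"
  by (auto intro: phi_Rats)

lemma phi_sum:
  assumes "J \<subseteq> A" "\<And>i. i \<in> I \<Longrightarrow> f i \<in> K"
  shows "\<phi> J (\<Sum>i\<in>I. f i) = (\<Sum>i\<in>I. \<phi> J (f i))"
  using assms by (induction I rule: infinite_finite_induct) (auto simp: phi_add sum_K)

lemma phi_prod:
  assumes "J \<subseteq> A" "\<And>i. i \<in> I \<Longrightarrow> f i \<in> K"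
  shows "\<phi> J (\<Prod>i\<in>I. f i) = (\<Prod>i\<in>I. \<phi> J (f i))"
  using assms by (induction I rule: infinite_finite_induct) (auto simp: phi_mult prod_K)

lemma phi_power: "J \<subseteq> A \<Longrightarrow> x \<in> K \<Longrightarrow> \<phi> J (x ^ n) = \<phi> J x ^ n"
  by (induction n) (auto simp: phi_mult power_K)

lemma phi_inverse: "J \<subseteq> A \<Longrightarrow> x \<in> K \<Longrightarrow> \<phi> J (inverse x) = inverse (\<phi> J x)"
  using phi_mult[of J x "inverse x"] inverse_K[of x]
  by (cases "x = 0") (auto intro: inverse_unique[symmetric])

lemma phi_powi: "J \<subseteq> A \<Longrightarrow> x \<in> K \<Longrightarrow> \<phi> J (x powi k) = \<phi> J x powi k"
  by (auto simp: power_int_def phi_power phi_inverse inverse_K)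

lemma phi_involution: "J \<subseteq> A \<Longrightarrow> x \<in> K \<Longrightarrow> \<phi> J (\<phi> J x) = x"
  by (simp add: phi_phi phi_empty)

lemma phi_eq_0_iff: "J \<subseteq> A \<Longrightarrow> x \<in> K \<Longrightarrow> \<phi> J x = 0 \<longleftrightarrow> x = 0"
  using phi_involution[of J x] by auto

lemma phi_algebraic_int:
  assumes "J \<subseteq> A" "x \<in> K" "algebraic_int x"
  shows "algebraic_int (\<phi> J x)"
proof -
  obtain p where p: "poly (map_poly of_int p) x = 0" "lead_coeff p = 1"
    using assms(3) by (auto simp: algebraic_int_altdef_ipoly)
  have "poly (map_poly of_int p) (\<phi> J x) = (\<Sum>i\<le>degree p. of_int (coeff p i) * \<phi> J x ^ i)"
    by (simp add: poly_altdef degree_map_poly coeff_map_poly)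
  also have "\<dots> = \<phi> J (\<Sum>i\<le>degree p. of_int (coeff p i) * x ^ i)"
    using assms by (simp add: phi_sum phi_mult phi_power mult_K power_K)
  also have "(\<Sum>i\<le>degree p. of_int (coeff p i) * x ^ i) = 0"
    using p(1) by (simp add: poly_altdef degree_map_poly coeff_map_poly)
  finally show ?thesis
    using p(2) assms(1) unfolding algebraic_int_altdef_ipoly by auto
qed

text \<open>An automorphism only permutes the conjugates by a translation of their indices, so the
  trace is rational, and a rational algebraic integer is an integer.\<close>

lemma trace_in_Ints:
  assumes "x \<in> K" "algebraic_int x"
  shows "(\<Sum>J\<in>Pow A. \<phi> J x) \<in> \<int>"
proof (rule rational_algebraic_int_is_int)
  show "algebraic_int (\<Sum>J\<in>Pow A. \<phi> J x)"
    using assms by (auto intro!: algebraic_int_sum phi_algebraic_int)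
  show "(\<Sum>J\<in>Pow A. \<phi> J x) \<in> \<rat>"
  proof (rule phi_fixed)
    fix H assume "H \<subseteq> A"
    thus "\<phi> H (\<Sum>J\<in>Pow A. \<phi> J x) = (\<Sum>J\<in>Pow A. \<phi> J x)"
      using assms sum_Pow_sym_diff[of H A "\<lambda>J. \<phi> J x"]
      by (subst phi_sum) (auto simp: phi_K phi_phi)
  qed (use assms in \<open>auto intro!: sum_K phi_K\<close>)
qed

lemma norm_in_Ints:
  assumes "x \<in> K" "algebraic_int x"
  shows "(\<Prod>J\<in>Pow A. \<phi> J x) \<in> \<int>"
proof (rule rational_algebraic_int_is_int)
  show "algebraic_int (\<Prod>J\<in>Pow A. \<phi> J x)"
    using assms by (auto intro!: algebraic_int_prod phi_algebraic_int)
  show "(\<Prod>J\<in>Pow A. \<phi> J x) \<in> \<rat>"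
  proof (rule phi_fixed)
    fix H assume "H \<subseteq> A"
    thus "\<phi> H (\<Prod>J\<in>Pow A. \<phi> J x) = (\<Prod>J\<in>Pow A. \<phi> J x)"
      using assms prod_Pow_sym_diff[of H A "\<lambda>J. \<phi> J x"]
      by (subst phi_prod) (auto simp: phi_K phi_phi)
  qed (use assms in \<open>auto intro!: prod_K phi_K\<close>)
qed

text \<open>The traces \<open>Tr (x * b)\<close> are bounded integers and determine \<open>x\<close>, since the trace form
  \<open>Tr (z * z)\<close> of a totally real field is positive definite.\<close>

lemma finite_bounded_conjugates:
  "finite {x \<in> K. algebraic_int x \<and> (\<forall>J\<subseteq>A. \<bar>\<phi> J x\<bar> \<le> C)}" (is "finite ?F")
proof -
  obtain B where B: "finite B" "B \<subseteq> K" "\<And>b. b \<in> B \<Longrightarrow> algebraic_int b"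
      "\<And>x. x \<in> K \<Longrightarrow> \<exists>q. (\<forall>b. q b \<in> \<rat>) \<and> x = (\<Sum>b\<in>B. q b * b)"
    using ex_integral_basis by blast
  define D where "D b = (\<Sum>J\<in>Pow A. C * \<bar>\<phi> J b\<bar>)" for b
  \<comment> \<open>The map is cut off outside \<open>B\<close>, so its values on the bounded
    elements lie in a finite product of finite sets of integers.\<close>
  define T where "T x = (\<lambda>b\<in>B. \<Sum>J\<in>Pow A. \<phi> J (x * b))" for x
  have "T ` ?F \<subseteq> (\<Pi>\<^sub>E b\<in>B. {t \<in> \<int>. \<bar>t\<bar> \<le> D b})"
  proof (clarsimp simp: T_def)
    fix x b assume x: "x \<in> K" "algebraic_int x" "\<forall>J\<subseteq>A. \<bar>\<phi> J x\<bar> \<le> C" and b: "b \<in> B"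
    have "\<bar>\<Sum>J\<in>Pow A. \<phi> J (x * b)\<bar> \<le> (\<Sum>J\<in>Pow A. \<bar>\<phi> J (x * b)\<bar>)"
      by (rule sum_abs)
    also have "\<dots> \<le> D b"
      unfolding D_def using x b B(2)
      by (intro sum_mono) (auto simp: phi_mult abs_mult subset_iff intro!: mult_right_mono)
    finally show "(\<Sum>J\<in>Pow A. \<phi> J (x * b)) \<in> \<int> \<and> \<bar>\<Sum>J\<in>Pow A. \<phi> J (x * b)\<bar> \<le> D b"
      using x b B by (auto intro!: trace_in_Ints mult_K algebraic_int_times)
  qed
  moreover have "finite (\<Pi>\<^sub>E b\<in>B. {t \<in> \<int>. \<bar>t\<bar> \<le> D b})"
    using B(1) by (intro finite_PiE finite_abs_int_segment)
  ultimately have "finite (T ` ?F)"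
    by (rule finite_subset)
  moreover have "inj_on T ?F"
  proof (rule inj_onI)
    fix x y assume xy: "x \<in> ?F" "y \<in> ?F" "T x = T y"
    define z where "z = x - y"
    have K: "x \<in> K" "y \<in> K" "z \<in> K"
      using xy by (auto simp: z_def intro: diff_K)
    have 0: "(\<Sum>J\<in>Pow A. \<phi> J (z * b)) = 0" if "b \<in> B" for b
    proof -
      have "b \<in> K" using that B by auto
      have "(\<Sum>J\<in>Pow A. \<phi> J (x * b)) = (\<Sum>J\<in>Pow A. \<phi> J (y * b))"
        using fun_cong[OF xy(3), of b] that by (simp add: T_def)
      moreover have "x * b = z * b + y * b"
        by (simp add: z_def algebra_simps)
      ultimately show ?thesis
        using K \<open>b \<in> K\<close> by (simp add: phi_add mult_K sum.distrib)
    qed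
    obtain q where q: "\<And>b. q b \<in> \<rat>" "z = (\<Sum>b\<in>B. q b * b)"
      using B(4)[OF K(3)] by blast
    have qK: "q b \<in> K" for b
      using q(1) Rats_K by auto
    \<comment> \<open>Only one of the two factors \<open>z\<close> is expanded in \<open>B\<close>;
      this makes the trace of \<open>z * z\<close> a rational combination of the traces of
      \<open>z * b\<close>, which vanish.\<close>
    have "(\<Sum>J\<in>Pow A. (\<phi> J z)\<^sup>2) = (\<Sum>J\<in>Pow A. \<phi> J (z * (\<Sum>b\<in>B. q b * b)))"
      unfolding q(2)[symmetric] using K by (intro sum.cong) (auto simp: phi_mult power2_eq_square)
    also have "\<dots> = (\<Sum>J\<in>Pow A. \<phi> J (\<Sum>b\<in>B. q b * (z * b)))"
      by (simp add: sum_distrib_left mult_ac)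
    also have "\<dots> = (\<Sum>J\<in>Pow A. \<Sum>b\<in>B. q b * \<phi> J (z * b))"
      using K B(2) qK q(1)
      by (intro sum.cong refl) (auto simp: phi_sum phi_mult phi_Rats mult_K subset_iff)
    also have "\<dots> = (\<Sum>b\<in>B. q b * (\<Sum>J\<in>Pow A. \<phi> J (z * b)))"
      by (subst sum.swap) (simp add: sum_distrib_left)
    also have "\<dots> = 0"
      using 0 by simp
    finally have "\<forall>J\<in>Pow A. (\<phi> J z)\<^sup>2 = 0"
      using finite_A by (subst (asm) sum_nonneg_eq_0_iff) auto
    hence "\<phi> {} z = 0" by auto
    thus "x = y" using K by (simp add: phi_empty z_def)
  qed
  ultimately show ?thesis
    by (rule finite_imageD)
qed

section \<open>Units and their components for the characters\<close>

definition unit_set :: "real set" where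
  "unit_set = {x \<in> K. x \<noteq> 0 \<and> algebraic_int x \<and> algebraic_int (inverse x)}"

lemma unit_setD:
  assumes "x \<in> unit_set"
  shows "x \<in> K" "x \<noteq> 0" "algebraic_int x" "algebraic_int (inverse x)"
  using assms by (auto simp: unit_set_def)

lemma unit_set_one: "1 \<in> unit_set"
  by (simp add: unit_set_def int_imp_algebraic_int)

lemma unit_set_mult: "x \<in> unit_set \<Longrightarrow> y \<in> unit_set \<Longrightarrow> x * y \<in> unit_set"
  by (auto simp: unit_set_def intro: mult_K algebraic_int_times)

lemma unit_set_inverse: "x \<in> unit_set \<Longrightarrow> inverse x \<in> unit_set"
  by (auto simp: unit_set_def intro: inverse_K)

lemma unit_set_phi: "J \<subseteq> A \<Longrightarrow> x \<in> unit_set \<Longrightarrow> \<phi> J x \<in> unit_set"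
  by (auto simp: unit_set_def phi_eq_0_iff simp flip: phi_inverse
      intro: phi_K inverse_K phi_algebraic_int)

lemma unit_set_prod: "(\<And>i. i \<in> I \<Longrightarrow> f i \<in> unit_set) \<Longrightarrow> (\<Prod>i\<in>I. f i) \<in> unit_set"
  by (induction I rule: infinite_finite_induct) (auto intro: unit_set_mult unit_set_one)

lemma unit_set_power: "x \<in> unit_set \<Longrightarrow> x ^ n \<in> unit_set"
  by (induction n) (auto intro: unit_set_mult unit_set_one)

lemma unit_set_powi: "x \<in> unit_set \<Longrightarrow> x powi k \<in> unit_set"
  by (auto simp: power_int_def intro: unit_set_power unit_set_inverse)

text \<open>The norms of a unit and of its inverse are integers with product 1.\<close>

lemma abs_norm_unit:
  assumes "u \<in> unit_set"
  shows "\<bar>\<Prod>J\<in>Pow A. \<phi> J u\<bar> = 1"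
proof -
  obtain a where a: "(\<Prod>J\<in>Pow A. \<phi> J u) = of_int a"
    using norm_in_Ints[of u] unit_setD[OF assms] by (auto elim: Ints_cases)
  obtain b where b: "(\<Prod>J\<in>Pow A. \<phi> J (inverse u)) = of_int b"
    using norm_in_Ints[of "inverse u"] unit_setD[OF assms] inverse_K by (auto elim: Ints_cases)
  have "of_int (a * b) = (\<Prod>J\<in>Pow A. \<phi> J u * \<phi> J (inverse u))"
    by (simp add: prod.distrib flip: a b)
  also have "\<dots> = (\<Prod>J\<in>Pow A. 1)"
    using unit_setD[OF assms] by (intro prod.cong) (auto simp: phi_inverse phi_eq_0_iff)
  finally have "a * b = 1" by (simp flip: of_int_mult)
  hence "\<bar>a\<bar> = 1" by (auto simp: zmult_eq_1_iff)
  thus ?thesis unfolding a by (metis of_int_1 of_int_abs)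
qed

text \<open>The component of \<open>x\<close> for the character \<open>sg I\<close> of the Galois group; the Galois group
  acts on it through this character.\<close>

definition component :: "'i set \<Rightarrow> real \<Rightarrow> real" where
  "component I x = (\<Prod>J\<in>Pow A. \<phi> J x powi sg I J)"

lemma component_unit: "x \<in> unit_set \<Longrightarrow> component I x \<in> unit_set"
  by (auto simp: component_def intro!: unit_set_prod unit_set_powi unit_set_phi)

lemma component_mult:
  "x \<in> K \<Longrightarrow> y \<in> K \<Longrightarrow> component I (x * y) = component I x * component I y"
  by (simp add: component_def phi_mult power_int_mult_distrib prod.distrib)

lemma component_prod:
  assumes "\<And>i. i \<in> T \<Longrightarrow> f i \<in> K"
  shows "component I (\<Prod>i\<in>T. f i) = (\<Prod>i\<in>T. component I (f i))"
  using assms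
  by (induction T rule: infinite_finite_induct)
     (auto simp: component_mult prod_K, simp_all add: component_def)

lemma component_powi: "x \<in> K \<Longrightarrow> component I (x powi k) = component I x powi k"
  by (simp add: component_def phi_powi power_int_prod mult.commute flip: power_int_mult)

lemma component_empty: "component {} x = (\<Prod>J\<in>Pow A. \<phi> J x)"
  by (simp add: component_def)

text \<open>Translating the index by \<open>H\<close> multiplies every exponent
  \<open>sg I J\<close> by the constant sign \<open>sg I H\<close>. An automorphism therefore fixes
  or inverts a component.\<close>

lemma phi_component:
  assumes "I \<subseteq> A" "H \<subseteq> A" "x \<in> K"
  shows "\<phi> H (component I x) = component I x powi sg I H"
proof -
  have fin: "J \<subseteq> A \<Longrightarrow> finite J" for J
    using finite_A finite_subset by blast
  have "\<phi> H (component I x) = (\<Prod>J\<in>Pow A. \<phi> (sym_diff H J) x powi sg I J)"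
    unfolding component_def using assms
    by (subst phi_prod) (auto simp: phi_powi phi_phi phi_K powi_K)
  also have "\<dots> = (\<Prod>J\<in>Pow A. \<phi> (sym_diff H J) x powi (sg I (sym_diff H J) * sg I H))"
    using assms fin by (intro prod.cong refl) (simp add: sg_sym_diff_right mult_ac)
  also have "\<dots> = (\<Prod>J\<in>Pow A. \<phi> J x powi (sg I J * sg I H))"
    using assms by (intro prod_Pow_sym_diff)
  also have "\<dots> = component I x powi sg I H"
    by (simp add: component_def power_int_prod power_int_mult)
  finally show ?thesis .
qed

text \<open>Summing the exponents over all characters kills every conjugate except the one for
  \<open>{}\<close>, which is \<open>x\<close>. So the components determine the absolute value of
  \<open>x\<close>.\<close>

lemma prod_component:
  assumes "x \<in> K" "x \<noteq> 0"
  shows "(\<Prod>I\<in>Pow A. component I x) = x ^ 2 ^ card A"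
proof -
  have "(\<Prod>I\<in>Pow A. component I x) = (\<Prod>J\<in>Pow A. \<Prod>I\<in>Pow A. \<phi> J x powi sg I J)"
    unfolding component_def by (rule prod.swap)
  also have "\<dots> = (\<Prod>J\<in>Pow A. \<phi> J x powi (if J = {} then 2 ^ card A else 0))"
    using assms finite_A
    by (intro prod.cong refl) (simp add: phi_eq_0_iff sum_sg flip: power_int_sum)
  also have "\<dots> = (\<Prod>J\<in>Pow A. if J = {} then x ^ 2 ^ card A else 1)"
    using assms power_int_of_nat[of x "2 ^ card A"]
    by (intro prod.cong refl) (auto simp: phi_empty)
  also have "\<dots> = x ^ 2 ^ card A"
    using finite_A by (simp add: prod.delta)
  finally show ?thesis .
qed

text \<open>Different characters annihilate each other, which allows one component to be adjusted
  without disturbing the others; the exponent for equal characters is the order of the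
  group.\<close>

lemma component_component:
  assumes "I \<subseteq> A" "L \<subseteq> A" "x \<in> K" "x \<noteq> 0"
  shows "component L (component I x) = (if L = I then component I x ^ 2 ^ card A else 1)"
proof -
  have fin: "J \<subseteq> A \<Longrightarrow> finite J" for J
    using finite_A finite_subset by blast
  have nz: "component I x \<noteq> 0"
    using assms finite_A by (auto simp: component_def phi_eq_0_iff)
  have "component L (component I x) = (\<Prod>J\<in>Pow A. component I x powi (sg I J * sg L J))"
    using assms by (subst component_def) (simp add: phi_component power_int_mult)
  also have "\<dots> = component I x powi (\<Sum>J\<in>Pow A. sg J (sym_diff I L))"
    using assms fin nz
    by (simp add: sg_sym_diff_right power_int_sum) (simp add: sg_commute)
  also have "(\<Sum>J\<in>Pow A. sg J (sym_diff I L)) = (if sym_diff I L = {} then 2 ^ card A else 0)"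
    using assms by (intro sum_sg finite_A) auto
  also have "sym_diff I L = {} \<longleftrightarrow> L = I" by auto
  also have "component I x powi (if L = I then 2 ^ card A else 0) =
      (if L = I then component I x ^ 2 ^ card A else 1)"
    using power_int_of_nat[of "component I x" "2 ^ card A"] by simp
  finally show ?thesis .
qed

text \<open>Let \<open>P\<close> and \<open>N\<close> be the products of the conjugates with sign 1
  and - 1, so that the component is their quotient. If their absolute values agreed,
  \<open>P * N = - 1\<close> would force \<open>P\<close> to be 1 or - 1, hence fixed by every
  automorphism. But an automorphism that reverses the sign exchanges \<open>P\<close> and
  \<open>N\<close>, so \<open>P = N\<close> and a real square would be - 1.\<close>

lemma abs_component_neq_1:
  assumes "x \<in> K" "(\<Prod>J\<in>Pow A. \<phi> J x) = - 1" "I \<subseteq> A" "I \<noteq> {}"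
  shows "\<bar>component I x\<bar> \<noteq> 1"
proof
  assume 1: "\<bar>component I x\<bar> = 1"
  obtain i where i: "i \<in> I" "i \<in> A" using assms by auto
  have fin: "J \<subseteq> A \<Longrightarrow> finite J" for J
    using finite_A finite_subset by blast
  define P where "P = (\<Prod>J\<in>{J\<in>Pow A. sg I J = 1}. \<phi> J x)"
  define N where "N = (\<Prod>J\<in>{J\<in>Pow A. sg I J = - 1}. \<phi> J x)"
  have split: "(\<Prod>J\<in>Pow A. f J) =
      (\<Prod>J\<in>{J\<in>Pow A. sg I J = 1}. f J) * (\<Prod>J\<in>{J\<in>Pow A. sg I J = - 1}. f J)"
    for f :: "'i set \<Rightarrow> real"
  proof -
    have "(\<Prod>J\<in>Pow A. f J) = (\<Prod>J\<in>{J\<in>Pow A. sg I J = 1} \<union> {J\<in>Pow A. sg I J = - 1}. f J)"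
      by (rule prod.cong) (use sg_cases[of I] in auto)
    also have "\<dots> = (\<Prod>J\<in>{J\<in>Pow A. sg I J = 1}. f J) * (\<Prod>J\<in>{J\<in>Pow A. sg I J = - 1}. f J)"
    proof (rule prod.union_disjoint)
      show "{J\<in>Pow A. sg I J = 1} \<inter> {J\<in>Pow A. sg I J = - 1} = {}"
      proof (rule equals0I)
        fix J assume "J \<in> {J\<in>Pow A. sg I J = 1} \<inter> {J\<in>Pow A. sg I J = - 1}"
        hence "sg I J = 1 \<and> sg I J = - 1" by blast
        hence "(1 :: int) = - 1" by (metis (no_types))
        thus False by presburger
      qed
    qed (simp_all only: finite_A finite_Pow_iff finite_Collect_conjI Collect_mem_eq simp_thms)
    finally show ?thesis .
  qed
  have PN: "P * N = - 1"
    using assms(2) split[of "\<lambda>J. \<phi> J x"] by (simp add: P_def N_def)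
  have "component I x = P * inverse N"
    unfolding component_def split P_def N_def
    by (simp add: power_int_minus flip: prod_inversef)
  hence "\<bar>P\<bar> = \<bar>N\<bar>"
    using 1 PN by (cases "N = 0") (auto simp: abs_mult field_simps)
  moreover have "\<bar>P\<bar> * \<bar>N\<bar> = 1"
    using PN by (metis abs_minus_cancel abs_mult abs_one)
  ultimately have "\<bar>P\<bar> * \<bar>P\<bar> = 1" by simp
  hence "\<bar>P\<bar> = 1 \<or> \<bar>P\<bar> = - 1" by (simp only: square_eq_1_iff)
  hence "\<bar>P\<bar> = 1" using abs_ge_zero[of P] by linarith
  hence "P \<in> \<rat>" by (auto simp: abs_if split: if_splits)
  hence "P = \<phi> {i} P"
    using i by (simp add: phi_Rats)
  also have "\<dots> = (\<Prod>J\<in>{J\<in>Pow A. sg I J = 1}. \<phi> (sym_diff {i} J) x)"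
    unfolding P_def using assms i by (subst phi_prod) (auto simp: phi_K phi_phi)
  also have "\<dots> = N"
    unfolding N_def
  proof (rule prod.reindex_bij_betw)
    have sg: "sg I (sym_diff {i} J) = - sg I J" if "J \<subseteq> A" for J
      using i fin[OF that] by (subst sg_sym_diff_right) (auto simp: sg_commute[of I "{i}"] sg_singleton)
    show "bij_betw (sym_diff {i}) {J\<in>Pow A. sg I J = 1} {J\<in>Pow A. sg I J = - 1}"
    proof (rule bij_betw_byWitness[of _ "sym_diff {i}"])
      show "sym_diff {i} ` {J\<in>Pow A. sg I J = 1} \<subseteq> {J\<in>Pow A. sg I J = - 1}"
        and "sym_diff {i} ` {J\<in>Pow A. sg I J = - 1} \<subseteq> {J\<in>Pow A. sg I J = 1}"
        unfolding image_subset_iff mem_Collect_eq Pow_iff using i sg by auto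
    qed auto
  qed
  finally have "P = N" .
  with PN have "P * P = - 1" by simp
  thus False using zero_le_square[of P] by simp
qed

section \<open>The subgroup generated by the conjugates of an element\<close>

definition conj_powers :: "real \<Rightarrow> real set" where
  "conj_powers x = {(\<Prod>J\<in>Pow A. \<phi> J x powi c J) | c. True}"

lemma conj_powersI: "(\<Prod>J\<in>Pow A. \<phi> J x powi c J) \<in> conj_powers x"
  by (auto simp: conj_powers_def)

lemma conj_powers_units: "x \<in> unit_set \<Longrightarrow> conj_powers x \<subseteq> unit_set"
  by (auto simp: conj_powers_def intro!: unit_set_prod unit_set_powi unit_set_phi)

lemma conj_powers_one: "1 \<in> conj_powers x"
  using conj_powersI[of x "\<lambda>_. 0"] by simp

lemma conj_powers_mult:
  assumes "x \<in> K" "x \<noteq> 0" "y \<in> conj_powers x" "z \<in> conj_powers x"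
  shows "y * z \<in> conj_powers x"
proof -
  obtain c d where "y = (\<Prod>J\<in>Pow A. \<phi> J x powi c J)" "z = (\<Prod>J\<in>Pow A. \<phi> J x powi d J)"
    using assms by (auto simp: conj_powers_def)
  hence "y * z = (\<Prod>J\<in>Pow A. \<phi> J x powi (c J + d J))"
    using assms by (simp add: power_int_add phi_eq_0_iff prod.distrib)
  thus ?thesis by (simp only: conj_powersI)
qed

lemma conj_powers_prod:
  assumes "x \<in> K" "x \<noteq> 0"
  shows "(\<And>i. i \<in> T \<Longrightarrow> f i \<in> conj_powers x) \<Longrightarrow> (\<Prod>i\<in>T. f i) \<in> conj_powers x"
  using assms
  by (induction T rule: infinite_finite_induct) (auto intro: conj_powers_one conj_powers_mult)

lemma conj_powers_powi:
  assumes "y \<in> conj_powers x"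
  shows "y powi k \<in> conj_powers x"
proof -
  obtain c where "y = (\<Prod>J\<in>Pow A. \<phi> J x powi c J)"
    using assms by (auto simp: conj_powers_def)
  hence "y powi k = (\<Prod>J\<in>Pow A. \<phi> J x powi (c J * k))"
    by (simp add: power_int_prod power_int_mult)
  thus ?thesis by (simp only: conj_powersI)
qed

lemma conj_powers_inverse: "y \<in> conj_powers x \<Longrightarrow> inverse y \<in> conj_powers x"
  using conj_powers_powi[of y x "- 1"] by (simp add: power_int_minus)

text \<open>The components of a norm \<open>- 1\<close> unit other than the norm itself have absolute value different
  from \<open>1\<close>, so suitable powers of them make all components of a given unit bounded.\<close>

lemma ex_bounded_representatives:
  assumes \<epsilon>: "\<epsilon> \<in> unit_set" "(\<Prod>J\<in>Pow A. \<phi> J \<epsilon>) = - 1"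
  shows "\<exists>C. \<forall>u\<in>unit_set. \<exists>w\<in>conj_powers \<epsilon>. \<forall>H\<subseteq>A. \<bar>\<phi> H (u * w)\<bar> \<le> C"
proof -
  note \<epsilon>K = unit_setD(1,2)[OF \<epsilon>(1)]
  define n where "n = (2 :: nat) ^ card A"
  \<comment> \<open>The power \<open>n\<close> comes from \<open>component_component\<close>:
    multiplying a unit by \<open>component I \<epsilon> powi k\<close> multiplies its component at
    \<open>I\<close> by \<open>b I powi k\<close> in absolute value and changes no other
    component.\<close>
  define b where "b I = \<bar>component I \<epsilon>\<bar> ^ n" for I
  have comp_nz: "component I x \<noteq> 0" if "x \<in> unit_set" for I x
    using unit_setD[OF component_unit[OF that]] by simp
  have b: "b I > 0" "b I \<noteq> 1" if "I \<subseteq> A" "I \<noteq> {}" for I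
    using comp_nz[OF \<epsilon>(1), of I] abs_component_neq_1[OF \<epsilon>K(1) \<epsilon>(2) that]
      power_eq_1_iff[of "\<bar>component I \<epsilon>\<bar>" n]
    by (auto simp: b_def n_def)
  \<comment> \<open>One constant for all characters and all units. The summand 1 also covers the
    trivial character, where the component of a unit is 1 or - 1.\<close>
  define C where "C = 1 + (\<Sum>I\<in>Pow A. max (b I) (inverse (b I)))"
  have b0: "b I \<ge> 0" for I by (simp add: b_def)
  have C: "max (b I) (inverse (b I)) \<le> C" if "I \<subseteq> A" for I
    using member_le_sum[of I "Pow A" "\<lambda>I. max (b I) (inverse (b I))"] that b0 finite_A
    by (auto simp: C_def le_max_iff_disj)
  have C1: "1 \<le> C"
    unfolding C_def using b0 by (simp add: sum_nonneg le_max_iff_disj)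
  have "\<exists>w\<in>conj_powers \<epsilon>. \<forall>H\<subseteq>A. \<bar>\<phi> H (u * w)\<bar> \<le> C" if u: "u \<in> unit_set" for u
  proof -
    have "\<forall>I. \<exists>k. I \<subseteq> A \<longrightarrow> I \<noteq> {} \<longrightarrow>
        1 \<le> \<bar>component I u\<bar> * b I powi k \<and> \<bar>component I u\<bar> * b I powi k \<le> max (b I) (inverse (b I))"
      using ex_power_int_normalize[OF _ b] comp_nz[OF u] by simp
    then obtain k where k: "\<And>I. I \<subseteq> A \<Longrightarrow> I \<noteq> {} \<Longrightarrow> 1 \<le> \<bar>component I u\<bar> * b I powi k I"
      "\<And>I. I \<subseteq> A \<Longrightarrow> I \<noteq> {} \<Longrightarrow> \<bar>component I u\<bar> * b I powi k I \<le> max (b I) (inverse (b I))"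
      by metis
    \<comment> \<open>The trivial character is left out: \<open>b\<close> equals 1 there, and the
      norm of \<open>u\<close> already has absolute value 1.\<close>
    define w where "w = (\<Prod>I\<in>Pow A - {{}}. component I \<epsilon> powi k I)"
    have comp_w: "component L w = (if L = {} then 1 else (component L \<epsilon> ^ n) powi k L)"
      if "L \<subseteq> A" for L
    proof -
      have "component L w = (\<Prod>I\<in>Pow A - {{}}. component L (component I \<epsilon>) powi k I)"
        unfolding w_def using \<epsilon>(1) unit_setD component_unit
        by (subst component_prod) (auto simp: component_powi powi_K)
      also have "\<dots> = (\<Prod>I\<in>Pow A - {{}}. if L = I then (component L \<epsilon> ^ n) powi k L else 1)"
        using that \<epsilon>K by (intro prod.cong) (auto simp: component_component n_def)
      also have "\<dots> = (if L = {} then 1 else (component L \<epsilon> ^ n) powi k L)"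
        using that finite_A by (simp add: prod.delta)
      finally show ?thesis .
    qed
    have w: "w \<in> conj_powers \<epsilon>"
      unfolding w_def component_def
      by (intro conj_powers_prod conj_powers_powi conj_powersI \<epsilon>K)
    hence wU: "w \<in> unit_set"
      using conj_powers_units \<epsilon>(1) by blast
    define v where "v = u * w"
    have v: "v \<in> unit_set" unfolding v_def by (rule unit_set_mult[OF u wU])
    have comp_v: "1 \<le> \<bar>component L v\<bar> \<and> \<bar>component L v\<bar> \<le> C" if L: "L \<subseteq> A" for L
    proof -
      have "component L v = component L u * component L w"
        unfolding v_def by (intro component_mult unit_setD u wU)
      hence *: "\<bar>component L v\<bar> = (if L = {} then 1 else \<bar>component L u\<bar> * b L powi k L)"
        using L abs_norm_unit[OF u]
        by (simp add: comp_w component_empty abs_mult power_int_abs power_abs b_def)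
      show ?thesis
      proof (cases "L = {}")
        case True
        hence "\<bar>component L v\<bar> = 1" using * by simp
        thus ?thesis using C1 by (simp only: order.refl simp_thms)
      next
        case False
        hence "\<bar>component L v\<bar> = \<bar>component L u\<bar> * b L powi k L" using * by simp
        thus ?thesis
          using k(1)[OF L False] order.trans[OF k(2)[OF L False] C[OF L]] by (simp only: simp_thms)
      qed
    qed
    have "\<bar>\<phi> H v\<bar> \<le> C" if H: "H \<subseteq> A" for H
    proof -
      \<comment> \<open>The power \<open>v ^ n\<close> is the product of the \<open>n\<close>
        components of \<open>v\<close>, and \<open>\<phi> H\<close> fixes or inverts each of them.
        Either way a factor is at most \<open>C\<close> in absolute value: the lower bound 1 takes
        care of the inverses.\<close>
      have "\<phi> H v ^ n = \<phi> H (v ^ n)"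
        using H unit_setD[OF v] by (simp add: phi_power)
      also have "v ^ n = (\<Prod>I\<in>Pow A. component I v)"
        unfolding n_def using unit_setD[OF v] by (simp add: prod_component)
      also have "\<phi> H \<dots> = (\<Prod>I\<in>Pow A. component I v powi sg I H)"
        using H v unit_setD component_unit by (subst phi_prod) (auto simp: phi_component)
      finally have "\<bar>\<phi> H v\<bar> ^ n = (\<Prod>I\<in>Pow A. \<bar>component I v\<bar> powi sg I H)"
        by (simp add: abs_prod power_int_abs flip: power_abs)
      also have "\<dots> \<le> (\<Prod>I\<in>Pow A. C)"
      proof (intro prod_mono conjI)
        fix I assume "I \<in> Pow A"
        hence I: "1 \<le> \<bar>component I v\<bar>" "\<bar>component I v\<bar> \<le> C" using comp_v by auto
        have "inverse \<bar>component I v\<bar> \<le> 1"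
          using I(1) by (simp add: inverse_le_1_iff)
        thus "\<bar>component I v\<bar> powi sg I H \<le> C"
          using I C1 sg_cases[of I H] by (auto simp: power_int_minus)
      qed simp
      also have "\<dots> = C ^ n"
        using finite_A by (simp add: n_def card_Pow)
      finally show ?thesis
        using C1 by (subst (asm) power_mono_iff) (auto simp: n_def)
    qed
    thus ?thesis using w unfolding v_def by blast
  qed
  thus ?thesis by blast
qed

text \<open>In the group ring of the Galois group over the field with two elements, the vector \<open>s\<close> of
  signs of the conjugates of \<open>\<epsilon>\<close> satisfies \<open>s * s = 1\<close>, because its augmentation is \<open>1\<close>. The
  sign vector of the product with exponents \<open>c\<close> is \<open>s * c\<close>, so it vanishes only if all
  exponents are even.\<close>

lemma even_exponents:
  assumes \<epsilon>: "\<epsilon> \<in> K" "\<epsilon> \<noteq> 0" "(\<Prod>J\<in>Pow A. \<phi> J \<epsilon>) = - 1"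
    and u: "u \<in> K" "u \<noteq> 0" "u * u = (\<Prod>J\<in>Pow A. \<phi> J \<epsilon> powi c J)"
    and L: "L \<subseteq> A"
  shows "even (c L)"
proof -
  define s :: "'i set \<Rightarrow> int" where "s J = (if \<phi> J \<epsilon> < 0 then 1 else 0)" for J
  have fin: "finite (Pow A)" using finite_A by simp
  have nz: "\<phi> J \<epsilon> \<noteq> 0" if "J \<subseteq> A" for J
    using that \<epsilon> by (simp add: phi_eq_0_iff)
  have ss: "s J * s J = s J" for J by (simp add: s_def)
  have "\<not> 0 < (\<Prod>J\<in>Pow A. \<phi> J \<epsilon> powi 1)"
    using \<epsilon>(3) by simp
  hence odd_s: "odd (\<Sum>J\<in>Pow A. s J)"
    using nz by (subst (asm) prod_power_int_pos_iff[OF fin]) (auto simp: s_def)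
  \<comment> \<open>Every conjugate of \<open>u * u\<close> is a nonzero square, hence positive; its
    sign, read as a parity, is the coefficient at \<open>H\<close> of the product of
    \<open>s\<close> and \<open>c\<close> in the group ring.\<close>
  have even_sc: "even (\<Sum>J\<in>Pow A. c J * s (sym_diff H J))" if H: "H \<subseteq> A" for H
  proof -
    have "0 < (\<phi> H u)\<^sup>2"
      using H u by (simp add: phi_eq_0_iff)
    also have "(\<phi> H u)\<^sup>2 = \<phi> H (\<Prod>J\<in>Pow A. \<phi> J \<epsilon> powi c J)"
      using H u by (simp add: power2_eq_square phi_mult flip: u(3))
    also have "\<dots> = (\<Prod>J\<in>Pow A. \<phi> (sym_diff H J) \<epsilon> powi c J)"
      using H \<epsilon> by (subst phi_prod) (auto simp: phi_powi powi_K phi_K phi_phi)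
    finally have pos: "0 < (\<Prod>J\<in>Pow A. \<phi> (sym_diff H J) \<epsilon> powi c J)" .
    have nz_H: "\<phi> (sym_diff H J) \<epsilon> \<noteq> 0" if "J \<in> Pow A" for J
    proof (rule nz)
      show "sym_diff H J \<subseteq> A" using H that by blast
    qed
    show ?thesis
      unfolding s_def by (rule iffD1[OF prod_power_int_pos_iff[OF fin nz_H] pos])
  qed
  \<comment> \<open>\<open>t J\<close> is the coefficient of \<open>s * s\<close> at
    \<open>sym_diff J L\<close>, the set by which the two arguments of \<open>s\<close>
    differ.\<close>
  define t where "t J = (\<Sum>H\<in>Pow A. s (sym_diff H L) * s (sym_diff H J))" for J
  have t_even: "even (t J)" if J: "J \<subseteq> A" "J \<noteq> L" for J
    unfolding t_def
  \<comment> \<open>Translating \<open>H\<close> by \<open>sym_diff J L\<close> swaps the two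
    factors and so preserves the term.\<close>
  proof (rule even_sum_Pow_involution[OF finite_A])
    show "sym_diff J L \<subseteq> A" "sym_diff J L \<noteq> {}" using J L by auto
    fix H assume "H \<subseteq> A"
    have "sym_diff (sym_diff (sym_diff J L) H) L = sym_diff H J"
      by blast
    moreover have "sym_diff (sym_diff (sym_diff J L) H) J = sym_diff H L"
      by blast
    ultimately show "s (sym_diff (sym_diff (sym_diff J L) H) L) * s (sym_diff (sym_diff (sym_diff J L) H) J) =
        s (sym_diff H L) * s (sym_diff H J)"
      by (simp only: mult.commute)
  qed
  \<comment> \<open>At \<open>L\<close> the two factors coincide, and \<open>s\<close> takes only
    the values 0 and 1, which leaves the augmentation of \<open>s\<close>.\<close>
  have "t L = (\<Sum>H\<in>Pow A. s (sym_diff L H))"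
    unfolding t_def ss by (simp only: Un_commute)
  also have "\<dots> = (\<Sum>J\<in>Pow A. s J)"
    by (rule sum_Pow_sym_diff[OF L])
  finally have t_odd: "odd (t L)" using odd_s by simp
  \<comment> \<open>Associativity in the group ring: both sides are the coefficient at
    \<open>L\<close> of the product of \<open>s\<close>, \<open>s\<close> and \<open>c\<close>,
    bracketed in two ways.\<close>
  have "(\<Sum>J\<in>Pow A. c J * t J) =
      (\<Sum>H\<in>Pow A. s (sym_diff H L) * (\<Sum>J\<in>Pow A. c J * s (sym_diff H J)))"
    unfolding t_def sum_distrib_left by (subst sum.swap) (simp only: mult.left_commute)
  also have "even \<dots>"
    using even_sc by (intro dvd_sum) auto
  finally have "even (c L * t L + (\<Sum>J\<in>Pow A - {L}. c J * t J))"
    using L fin by (simp add: sum.remove[of "Pow A" L])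
  moreover have "even (\<Sum>J\<in>Pow A - {L}. c J * t J)"
    using t_even by (intro dvd_sum) auto
  ultimately show ?thesis using t_odd by simp
qed

text \<open>Halving the even exponents gives an element of the subgroup with the same square as
  \<open>u\<close>, so it is \<open>u\<close> or \<open>- u\<close>; the sign is absorbed because -
  1 lies in the subgroup.\<close>

lemma conj_powers_square_root:
  assumes \<epsilon>: "\<epsilon> \<in> unit_set" "(\<Prod>J\<in>Pow A. \<phi> J \<epsilon>) = - 1"
    and u: "u \<in> unit_set" "u * u \<in> conj_powers \<epsilon>"
  shows "u \<in> conj_powers \<epsilon>"
proof -
  note \<epsilon>K = unit_setD(1,2)[OF \<epsilon>(1)]
  obtain c where c: "u * u = (\<Prod>J\<in>Pow A. \<phi> J \<epsilon> powi c J)"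
    using u(2) by (auto simp: conj_powers_def)
  define w where "w = (\<Prod>J\<in>Pow A. \<phi> J \<epsilon> powi (c J div 2))"
  have w: "w \<in> conj_powers \<epsilon>"
    unfolding w_def by (rule conj_powersI)
  have "w * w = (\<Prod>J\<in>Pow A. \<phi> J \<epsilon> powi (c J div 2 + c J div 2))"
    unfolding w_def prod.distrib[symmetric]
  proof (intro prod.cong refl)
    fix J assume "J \<in> Pow A"
    hence "\<phi> J \<epsilon> \<noteq> 0" using \<epsilon>K by (simp add: phi_eq_0_iff)
    thus "\<phi> J \<epsilon> powi (c J div 2) * \<phi> J \<epsilon> powi (c J div 2) = \<phi> J \<epsilon> powi (c J div 2 + c J div 2)"
      by (subst power_int_add) simp_all
  qed
  also have "\<dots> = u * u"
    unfolding c
  proof (intro prod.cong refl)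
    fix J assume "J \<in> Pow A"
    hence "even (c J)"
      using even_exponents[OF \<epsilon>K \<epsilon>(2) unit_setD(1,2)[OF u(1)] c] by blast
    hence "c J div 2 + c J div 2 = c J" by presburger
    thus "\<phi> J \<epsilon> powi (c J div 2 + c J div 2) = \<phi> J \<epsilon> powi c J" by (simp only:)
  qed
  finally have "w = u \<or> w = - u"
    by (simp only: square_eq_iff)
  hence "u = w \<or> u = (- 1) * w" by (elim disjE) simp_all
  moreover have "- 1 \<in> conj_powers \<epsilon>"
    using conj_powersI[of \<epsilon> "\<lambda>_. 1"] \<epsilon>(2) by simp
  hence "(- 1) * w \<in> conj_powers \<epsilon>"
    by (rule conj_powers_mult[OF \<epsilon>K _ w])
  ultimately show ?thesis
    using w by metis
qed

end

section \<open>Groups of odd order\<close>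

lemma (in group) odd_order_if_no_involution:
  assumes "finite (carrier G)"
    and no_inv: "\<And>x. x \<in> carrier G \<Longrightarrow> x \<otimes> x = \<one> \<Longrightarrow> x = \<one>"
  shows "odd (Coset.order G)"
proof
  assume "even (Coset.order G)"
  \<comment> \<open>\<open>m\<close> may itself be even: \<open>sylow_thm\<close> covers every power
    of a prime that divides the order, and with exponent 1 it gives Cauchy's theorem.\<close>
  then obtain m where m: "Coset.order G = 2 ^ 1 * m" by (auto elim: evenE)
  have "Factorial_Ring.prime (2 :: nat)" by (rule two_is_prime_nat)
  then obtain H where H: "subgroup H G" "card H = 2"
    using sylow_thm[OF _ is_group m assms(1)] by auto
  have "\<one> \<in> H" by (rule subgroup.one_closed[OF H(1)])
  then obtain x where x: "x \<noteq> \<one>" "H = {\<one>, x}"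
    using H(2) unfolding card_2_iff by (metis doubleton_eq_iff insertE singletonD)
  have "x \<otimes> x \<in> H" "x \<in> carrier G"
    using subgroup.m_closed[OF H(1), of x x] subgroup.mem_carrier[OF H(1), of x] x(2) by simp_all
  moreover from this have "x \<otimes> x \<noteq> x"
    using x(1) l_cancel_one[of x x] by simp
  ultimately have "x \<otimes> x = \<one>"
    unfolding x(2) by simp
  thus False using no_inv \<open>x \<in> carrier G\<close> x(1) by blast
qed

text \<open>The condition \<open>root\<close> says that the quotient by \<open>S\<close> has no
  element of order 2.\<close>

lemma (in comm_group) odd_card_rcosets:
  assumes S: "subgroup S G" and fin: "finite (rcosets S)"
    and root: "\<And>x. x \<in> carrier G \<Longrightarrow> x \<otimes> x \<in> S \<Longrightarrow> x \<in> S"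
  shows "odd (card (rcosets S))"
proof -
  have N: "S \<lhd> G"
    by (rule subgroup_imp_normal[OF S])
  interpret Q: group "G Mod S"
    by (rule normal.factorgroup_is_group[OF N])
  have "odd (Coset.order (G Mod S))"
  proof (rule Q.odd_order_if_no_involution)
    show "finite (carrier (G Mod S))"
      using fin by (simp add: FactGroup_def)
  next
    fix Y assume Y: "Y \<in> carrier (G Mod S)" and YY: "Y \<otimes>\<^bsub>G Mod S\<^esub> Y = \<one>\<^bsub>G Mod S\<^esub>"
    from Y obtain x where x: "x \<in> carrier G" "Y = S #> x"
      by (auto simp: FactGroup_def RCOSETS_def)
    have "S #> (x \<otimes> x) = S"
      using YY x normal.rcos_sum[OF N x(1) x(1)] by (simp add: FactGroup_def)
    hence "x \<otimes> x \<in> S"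
      by (rule coset_join1) (use x(1) S in simp_all)
    hence "x \<in> S" by (rule root[OF x(1)])
    thus "Y = \<one>\<^bsub>G Mod S\<^esub>"
      using x S by (simp add: FactGroup_def coset_join2)
  qed
  thus ?thesis by (simp add: Coset.order_def FactGroup_def)
qed

lemma (in comm_group) finite_rcosets_if_finite_representatives:
  assumes S: "subgroup S G" and "finite F"
    and rep: "\<And>u. u \<in> carrier G \<Longrightarrow> \<exists>w\<in>S. u \<otimes> w \<in> F"
  shows "finite (rcosets S)"
proof (rule finite_subset)
  show "rcosets S \<subseteq> (\<lambda>v. S #> v) ` F"
  proof
    fix Y assume "Y \<in> rcosets S"
    then obtain u where u: "u \<in> carrier G" "Y = S #> u"
      by (auto simp: RCOSETS_def)
    obtain w where w: "w \<in> S" "u \<otimes> w \<in> F" using rep[OF u(1)] by blast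
    have wG: "w \<in> carrier G" using w S by (auto dest: subgroup.mem_carrier)
    have "S #> (u \<otimes> w) = S #> (w \<otimes> u)"
      using u wG by (simp add: m_comm)
    also have "\<dots> = (S #> w) #> u"
      using u wG subgroup.subset[OF S] by (simp add: coset_mult_assoc)
    also have "S #> w = S"
      using wG S w(1) by (rule coset_join2)
    finally show "Y \<in> (\<lambda>v. S #> v) ` F"
      using u w by blast
  qed
qed (use assms(2) in simp)

section \<open>Square roots and the fields they generate\<close>

lemma real_ring_simps [simp]:
  "carrier real_ring = UNIV" "x \<otimes>\<^bsub>real_ring\<^esub> y = x * y" "\<one>\<^bsub>real_ring\<^esub> = 1"
  "x \<oplus>\<^bsub>real_ring\<^esub> y = x + y" "\<zero>\<^bsub>real_ring\<^esub> = 0"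
  by (simp_all add: ring_of_type_algebra_def)

lemma real_ring_uminus [simp]: "\<ominus>\<^bsub>real_ring\<^esub> x = - x"
proof -
  interpret field real_ring by (rule field_from_type_algebra)
  show ?thesis by (rule minus_equality) simp_all
qed

lemma real_ring_inverse: "x \<noteq> 0 \<Longrightarrow> inv\<^bsub>real_ring\<^esub> x = inverse x"
proof -
  assume "x \<noteq> 0"
  interpret field real_ring by (rule field_from_type_algebra)
  show ?thesis using \<open>x \<noteq> 0\<close> by (intro comm_inv_char) simp_all
qed

lemma subfield_Rats: "subfield \<rat> real_ring"
proof -
  interpret field real_ring by (rule field_from_type_algebra)
  show ?thesis
  proof (rule subfieldI')
    show "subring \<rat> real_ring"
      by (rule subringI) (simp_all add: Rats_add Rats_mult)
    show "inv\<^bsub>real_ring\<^esub> k \<in> \<rat>" if "k \<in> \<rat> - {\<zero>\<^bsub>real_ring\<^esub>}" for k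
      using that by (simp add: real_ring_inverse)
  qed
qed

text \<open>A vector already in the span adds no dimension, any other adds one. The length is only a
  bound because the list may be dependent.\<close>

lemma (in ring) dimension_Span_le:
  assumes K: "subfield K R" and "set Us \<subseteq> carrier R"
  shows "\<exists>n\<le>length Us. dimension n K (Span K Us)"
  using assms(2)
proof (induction Us)
  case (Cons u Us)
  then obtain n where n: "n \<le> length Us" "dimension n K (Span K Us)" by auto
  show ?case
  proof (cases "u \<in> Span K Us")
    case True
    have "Span K (u # Us) \<subseteq> Span K Us"
      using True Cons.prems mono_Span_subset[OF K, of "u # Us" Us] Span_base_incl[OF K, of Us]
      by simp
    moreover have "Span K Us \<subseteq> Span K (u # Us)"
      using Cons.prems by (intro mono_Span_subset[OF K] order.trans[OF _ Span_base_incl[OF K]]) auto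
    ultimately have "Span K (u # Us) = Span K Us" by blast
    thus ?thesis using n by (metis le_SucI length_Cons)
  next
    case False
    have "dimension (Suc n) K (line_extension K u (Span K Us))"
      using Cons.prems False n(2) by (intro Suc_dim) auto
    thus ?thesis using n(1) by (intro exI[of _ "Suc n"]) simp
  qed
qed auto

definition rad :: "('i \<Rightarrow> nat) \<Rightarrow> 'i set \<Rightarrow> real" where
  "rad d I = (\<Prod>i\<in>I. sqrt (real (d i)))"

text \<open>An additive normal form for the field generated by the roots, see
  \<open>generate_field_sqrt\<close>. Coefficients are rational at every set, also outside
  \<open>Pow A\<close>, so that they can be used without membership conditions.\<close>

definition rad_span :: "('i \<Rightarrow> nat) \<Rightarrow> 'i set \<Rightarrow> real set" where
  "rad_span d A = {(\<Sum>I\<in>Pow A. q I * rad d I) | q. \<forall>I. q I \<in> \<rat>}"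

lemma rad_empty [simp]: "rad d {} = 1"
  by (simp add: rad_def)

lemma rad_insert: "finite I \<Longrightarrow> i \<notin> I \<Longrightarrow> rad d (insert i I) = sqrt (real (d i)) * rad d I"
  by (simp add: rad_def)

text \<open>Roots with a common index multiply to integers. Up to rational factors, radicals thus
  multiply like their index sets under symmetric difference.\<close>

lemma rad_mult:
  assumes "finite I" "finite H"
  shows "rad d I * rad d H = real (\<Prod>i\<in>I \<inter> H. d i) * rad d (sym_diff I H)"
proof -
  have I: "rad d I = rad d (I - H) * rad d (I \<inter> H)"
    unfolding rad_def using assms by (subst prod.union_disjoint[symmetric]) (auto intro: prod.cong)
  have H: "rad d H = rad d (H - I) * rad d (I \<inter> H)"
    unfolding rad_def using assms by (subst prod.union_disjoint[symmetric]) (auto intro: prod.cong)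
  have S: "rad d (sym_diff I H) = rad d (I - H) * rad d (H - I)"
    unfolding rad_def using assms by (subst prod.union_disjoint) auto
  have "rad d (I \<inter> H) * rad d (I \<inter> H) = real (\<Prod>i\<in>I \<inter> H. d i)"
    unfolding rad_def by (simp flip: prod.distrib)
  thus ?thesis by (simp add: I H S mult_ac)
qed

lemma algebraic_int_rad: "algebraic_int (rad d I)"
  unfolding rad_def by (intro algebraic_int_prod algebraic_int_sqrt int_imp_algebraic_int Ints_of_nat)

lemma rad_span_I: "(\<And>I. q I \<in> \<rat>) \<Longrightarrow> (\<Sum>I\<in>Pow A. q I * rad d I) \<in> rad_span d A"
  by (auto simp: rad_span_def)

lemma rad_spanE:
  assumes "x \<in> rad_span d A"
  obtains q where "\<And>I. q I \<in> \<rat>" "x = (\<Sum>I\<in>Pow A. q I * rad d I)"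
  using assms by (auto simp: rad_span_def)

lemma rad_span_base:
  assumes "finite A" "I \<subseteq> A" "q \<in> \<rat>"
  shows "q * rad d I \<in> rad_span d A"
proof -
  have "q * rad d I = (\<Sum>H\<in>Pow A. (if H = I then q else 0) * rad d H)"
    using assms by (simp add: if_distrib[of "\<lambda>x. x * _"] cong: if_cong)
  thus ?thesis using assms(3) rad_span_I[of "\<lambda>H. if H = I then q else 0" d A] by simp
qed

lemma rad_span_add:
  assumes "x \<in> rad_span d A" "y \<in> rad_span d A"
  shows "x + y \<in> rad_span d A"
proof -
  obtain q where q: "\<And>I. q I \<in> \<rat>" "x = (\<Sum>I\<in>Pow A. q I * rad d I)"
    using assms(1) by (rule rad_spanE) blast
  obtain r where r: "\<And>I. r I \<in> \<rat>" "y = (\<Sum>I\<in>Pow A. r I * rad d I)"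
    using assms(2) by (rule rad_spanE) blast
  have "x + y = (\<Sum>I\<in>Pow A. (q I + r I) * rad d I)"
    by (simp add: q r distrib_right sum.distrib)
  thus ?thesis using q(1) r(1) rad_span_I[of "\<lambda>I. q I + r I" d A] by (simp add: Rats_add)
qed

lemma rad_span_sum:
  "(\<And>i. i \<in> T \<Longrightarrow> f i \<in> rad_span d A) \<Longrightarrow> (\<Sum>i\<in>T. f i) \<in> rad_span d A"
  using rad_span_I[of "\<lambda>_. 0" d A]
  by (induction T rule: infinite_finite_induct) (auto intro: rad_span_add)

lemma rad_span_mult:
  assumes "finite A" "x \<in> rad_span d A" "y \<in> rad_span d A"
  shows "x * y \<in> rad_span d A"
proof -
  obtain q where q: "\<And>I. q I \<in> \<rat>" "x = (\<Sum>I\<in>Pow A. q I * rad d I)"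
    using assms(2) by (rule rad_spanE) blast
  obtain r where r: "\<And>I. r I \<in> \<rat>" "y = (\<Sum>I\<in>Pow A. r I * rad d I)"
    using assms(3) by (rule rad_spanE) blast
  have "x * y = (\<Sum>I\<in>Pow A. \<Sum>H\<in>Pow A. q I * r H * (rad d I * rad d H))"
    by (simp add: q r sum_product mult_ac)
  also have "\<dots> \<in> rad_span d A"
  proof (intro rad_span_sum)
    fix I H assume IH: "I \<in> Pow A" "H \<in> Pow A"
    hence fin: "finite I" "finite H" using assms(1) by (auto dest: finite_subset)
    have "q I * r H * (rad d I * rad d H) = q I * r H * real (\<Prod>i\<in>I \<inter> H. d i) * rad d (sym_diff I H)"
      by (simp only: rad_mult[OF fin] mult.assoc)
    also have "\<dots> \<in> rad_span d A"
      using IH q(1) r(1) by (intro rad_span_base assms(1) Rats_mult Rats_of_nat) auto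
    finally show "q I * r H * (rad d I * rad d H) \<in> rad_span d A" .
  qed
  finally show ?thesis .
qed

lemma Rats_rad_span: "finite A \<Longrightarrow> \<rat> \<subseteq> rad_span d A"
  using rad_span_base[of A "{}" _ d] by auto

lemma rad_span_uminus: "finite A \<Longrightarrow> x \<in> rad_span d A \<Longrightarrow> - x \<in> rad_span d A"
  using rad_span_mult[of A "- 1" d x] Rats_rad_span[of A d] by (auto simp: subset_iff)

lemma rad_span_diff: "finite A \<Longrightarrow> x \<in> rad_span d A \<Longrightarrow> y \<in> rad_span d A \<Longrightarrow> x - y \<in> rad_span d A"
  using rad_span_add[of x d A "- y"] rad_span_uminus[of A y d] by simp

lemma rad_span_mono:
  assumes "finite B" "A \<subseteq> B"
  shows "rad_span d A \<subseteq> rad_span d B"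
proof
  fix x assume "x \<in> rad_span d A"
  then obtain q where q: "\<And>I. q I \<in> \<rat>" "x = (\<Sum>I\<in>Pow A. q I * rad d I)"
    by (rule rad_spanE) blast
  show "x \<in> rad_span d B"
    unfolding q(2) using assms q(1) by (intro rad_span_sum rad_span_base) auto
qed

lemma sqrt_in_rad_span:
  assumes "finite A" "i \<in> A"
  shows "sqrt (real (d i)) \<in> rad_span d A"
  using rad_span_base[of A "{i}" 1 d] assms by (simp add: rad_def)

lemma rad_span_insertE:
  assumes "finite A" "i \<notin> A" "x \<in> rad_span d (insert i A)"
  obtains a b where "a \<in> rad_span d A" "b \<in> rad_span d A" "x = a + b * sqrt (real (d i))"
proof -
  obtain q where q: "\<And>I. q I \<in> \<rat>" "x = (\<Sum>I\<in>Pow (insert i A). q I * rad d I)"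
    using assms(3) by (rule rad_spanE) blast
  have "x = (\<Sum>I\<in>Pow A. q I * rad d I) + (\<Sum>I\<in>insert i ` Pow A. q I * rad d I)"
    unfolding q(2) Pow_insert using assms by (intro sum.union_disjoint) auto
  also have "(\<Sum>I\<in>insert i ` Pow A. q I * rad d I) = (\<Sum>I\<in>Pow A. q (insert i I) * rad d (insert i I))"
    using assms(2) by (intro sum.reindex_cong[of "insert i"]) (auto simp: inj_on_def)
  also have "\<dots> = (\<Sum>I\<in>Pow A. q (insert i I) * rad d I) * sqrt (real (d i))"
    unfolding sum_distrib_right
  proof (intro sum.cong refl)
    fix I assume "I \<in> Pow A"
    hence "finite I" "i \<notin> I" using assms by (auto dest: finite_subset)
    thus "q (insert i I) * rad d (insert i I) = q (insert i I) * rad d I * sqrt (real (d i))"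
      by (simp add: rad_insert)
  qed
  finally show ?thesis
    using q(1) by (intro that[OF rad_span_I rad_span_I]) auto
qed

text \<open>Rationalising the denominator, by induction on the set of roots. The new root may depend
  on the old ones, so \<open>a - b * ?s\<close> may vanish although \<open>x\<close> does not; then
  \<open>x = a + a\<close> already lies in the smaller span.\<close>

lemma rad_span_inverse:
  assumes "finite A" "x \<in> rad_span d A"
  shows "inverse x \<in> rad_span d A"
  using assms
proof (induction A arbitrary: x rule: finite_induct)
  case empty
  then obtain q where q: "\<And>I. q I \<in> \<rat>" "x = (\<Sum>I\<in>Pow {}. q I * rad d I)"
    by (elim rad_spanE) blast
  hence "inverse x \<in> \<rat>" by simp
  thus ?case using Rats_rad_span[of "{}" d] by auto
next
  case (insert i A)
  let ?s = "sqrt (real (d i))" and ?L = "rad_span d (insert i A)"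
  have fin: "finite (insert i A)" using insert.hyps by simp
  have L: "rad_span d A \<subseteq> ?L"
    by (rule rad_span_mono[OF fin]) auto
  have s: "?s \<in> ?L" using fin by (intro sqrt_in_rad_span) auto
  obtain a b where ab: "a \<in> rad_span d A" "b \<in> rad_span d A" "x = a + b * ?s"
    using rad_span_insertE[OF insert.hyps insert.prems] by blast
  show ?case
  proof (cases "x \<in> rad_span d A")
    case True
    thus ?thesis using insert.IH L by blast
  next
    case False
    define n where "n = a * a - b * b * real (d i)"
    have n: "n \<in> rad_span d A"
      unfolding n_def using ab insert.hyps Rats_rad_span[of A d]
      by (intro rad_span_diff rad_span_mult) auto
    have n_eq: "n = x * (a - b * ?s)"
      by (simp add: n_def ab(3) algebra_simps)
    have "a - b * ?s \<noteq> 0"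
    proof
      assume "a - b * ?s = 0"
      hence "x = a + a" using ab by simp
      thus False using False ab rad_span_add by blast
    qed
    hence "inverse x = inverse n * (a - b * ?s)"
      unfolding n_eq by simp
    also have "\<dots> \<in> ?L"
      using insert.IH[OF n] L ab s fin
      by (intro rad_span_mult rad_span_diff) auto
    finally show ?thesis .
  qed
qed

lemma generate_field_sqrt:
  assumes "finite A"
  shows "generate_field real_ring ((\<lambda>i. sqrt (real (d i))) ` A) = rad_span d A" (is "?L = _")
proof
  show "?L \<subseteq> rad_span d A"
  proof
    fix x assume "x \<in> ?L"
    thus "x \<in> rad_span d A"
    proof (induction rule: generate_field.induct)
      case one
      thus ?case using Rats_rad_span[OF assms, of d] by auto
    next
      case (incl h)
      thus ?case using assms by (auto intro: sqrt_in_rad_span)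
    next
      case (m_inv h)
      thus ?case using assms by (simp add: real_ring_inverse rad_span_inverse)
    qed (simp_all add: assms rad_span_uminus rad_span_add rad_span_mult)
  qed
next
  interpret field real_ring by (rule field_from_type_algebra)
  have add: "x + y \<in> ?L" if "x \<in> ?L" "y \<in> ?L" for x y
    using generate_field.eng_add[OF that] by simp
  have mult: "x * y \<in> ?L" if "x \<in> ?L" "y \<in> ?L" for x y
    using generate_field.eng_mult[OF that] by simp
  have minus: "- x \<in> ?L" if "x \<in> ?L" for x
    using generate_field.a_inv[OF that] by simp
  have one: "1 \<in> ?L"
    using generate_field.one[of real_ring] by simp
  have zero: "0 \<in> ?L"
    using add[OF one minus[OF one]] by simp
  have nat: "of_nat n \<in> ?L" for n
    by (induction n) (auto intro: zero one add)
  have int: "of_int k \<in> ?L" for k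
    by (cases k) (use nat minus[OF nat] in \<open>auto simp del: of_nat_Suc\<close>)
  have inverse: "inverse x \<in> ?L" if "x \<in> ?L" for x
    using generate_field.m_inv[OF that] zero by (cases "x = 0") (auto simp: real_ring_inverse)
  have rat: "q \<in> ?L" if "q \<in> \<rat>" for q
  proof -
    obtain a b :: int where "q = of_int a / of_int b"
      using \<open>q \<in> \<rat>\<close> by (elim Rats_cases') blast
    hence "q = of_int a * inverse (of_int b)" by (simp add: divide_inverse)
    thus ?thesis by (simp only: mult int inverse)
  qed
  have sqrt: "sqrt (real (d i)) \<in> ?L" if "i \<in> A" for i
    by (rule generate_field.incl) (use that in blast)
  have rad: "rad d I \<in> ?L" if "I \<subseteq> A" for I
  proof -
    have "finite I" using that assms by (rule finite_subset)
    thus ?thesis using that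
      by (induction I rule: finite_induct) (auto simp: rad_insert intro!: one mult sqrt)
  qed
  have sum: "(\<Sum>i\<in>T. f i) \<in> ?L" if "\<And>i. i \<in> T \<Longrightarrow> f i \<in> ?L" for T :: "'a set set" and f
    using that by (induction T rule: infinite_finite_induct) (auto intro: zero add)
  show "rad_span d A \<subseteq> ?L"
  proof
    fix x assume "x \<in> rad_span d A"
    then obtain q where q: "\<And>I. q I \<in> \<rat>" "x = (\<Sum>I\<in>Pow A. q I * rad d I)"
      by (rule rad_spanE) blast
    show "x \<in> ?L"
      unfolding q(2) using rat[OF q(1)] rad by (auto intro!: sum mult)
  qed
qed

text \<open>A relation with a nonzero coefficient expresses one radical by the others, so fewer than
  \<open>2 ^ card A\<close> elements would span a space containing \<open>2 ^ card A\<close>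
  independent vectors.\<close>

lemma rad_independent:
  assumes fin: "finite A" and dim: "ring.dimension real_ring (2 ^ card A) \<rat> (rad_span d A)"
    and q: "\<And>I. q I \<in> \<rat>" "(\<Sum>I\<in>Pow A. q I * rad d I) = 0" and I0: "I0 \<subseteq> A"
  shows "q I0 = 0"
proof (rule ccontr)
  assume nz: "q I0 \<noteq> 0"
  interpret R: field real_ring by (rule field_from_type_algebra)
  note Q = subfield_Rats
  obtain xs where xs: "set xs = Pow A - {I0}" "distinct xs"
    using finite_distinct_list[of "Pow A - {I0}"] fin by auto
  define Us where "Us = map (rad d) xs"
  have sub: "set Us \<subseteq> carrier real_ring" by simp
  have len: "length Us < 2 ^ card A"
  proof -
    have "length Us = 2 ^ card A - 1"
      using distinct_card[OF xs(2)] xs(1) I0 fin by (simp add: Us_def card_Pow)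
    moreover have "(0 :: nat) < 2 ^ card A" by simp
    ultimately show ?thesis by linarith
  qed
  have add: "x + y \<in> R.Span \<rat> Us" if "x \<in> R.Span \<rat> Us" "y \<in> R.Span \<rat> Us" for x y
    using R.Span_subgroup_props(3)[OF Q sub that] by simp
  have scale: "c * x \<in> R.Span \<rat> Us" if "c \<in> \<rat>" "x \<in> R.Span \<rat> Us" for c x
    using R.Span_smult_closed[OF Q sub that] by simp
  have sum: "(\<Sum>i\<in>T. f i) \<in> R.Span \<rat> Us" if "\<And>i. i \<in> T \<Longrightarrow> f i \<in> R.Span \<rat> Us"
    for T :: "'a set set" and f
    using that R.Span_subgroup_props(2)[OF Q sub]
    by (induction T rule: infinite_finite_induct) (auto intro: add simp del: R.Span.simps)
  have rad': "rad d I \<in> R.Span \<rat> Us" if "I \<in> Pow A - {I0}" for I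
    using R.Span_base_incl[OF Q sub] that xs(1) by (auto simp: Us_def simp del: R.Span.simps)
  have "q I0 * rad d I0 = - (\<Sum>I\<in>Pow A - {I0}. q I * rad d I)"
    using q(2) I0 fin by (simp add: sum.remove[of "Pow A" I0])
  hence "rad d I0 = - (\<Sum>I\<in>Pow A - {I0}. q I * rad d I) / q I0"
    using nz by (simp add: field_simps)
  also have "\<dots> = (\<Sum>I\<in>Pow A - {I0}. (- q I / q I0) * rad d I)"
    by (simp add: sum_divide_distrib sum_negf)
  also have "\<dots> \<in> R.Span \<rat> Us"
    using q(1) by (intro sum scale rad') auto
  finally have rad: "rad d I \<in> R.Span \<rat> Us" if "I \<in> Pow A" for I
    using rad'[of I] that by (cases "I = I0") (auto simp del: R.Span.simps)
  have span: "rad_span d A \<subseteq> R.Span \<rat> Us"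
    by (auto simp: rad_span_def simp del: R.Span.simps intro!: sum scale rad)
  obtain Vs where Vs: "R.independent \<rat> Vs" "length Vs = 2 ^ card A" "R.Span \<rat> Vs = rad_span d A"
    using R.exists_base[OF Q dim] by blast
  have "set Vs \<subseteq> R.Span \<rat> Us"
    using R.Span_base_incl[OF Q, of Vs] Vs(3) span by simp
  obtain n where n: "n \<le> length Us" "R.dimension n \<rat> (R.Span \<rat> Us)"
    using R.dimension_Span_le[OF Q sub] by blast
  have "length Vs \<le> n"
    by (rule R.independent_length_le_dimension[OF Q n(2) Vs(1)]) fact
  thus False using len n(1) Vs(2) by simp
qed

section \<open>The Galois group of a multiquadratic field\<close>

locale independent_radicals =
  fixes A :: "'i set" and d :: "'i \<Rightarrow> nat"
  assumes fin: "finite A"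
    and independent: "\<And>q I. (\<And>I. q I \<in> \<rat>) \<Longrightarrow> (\<Sum>I\<in>Pow A. q I * rad d I) = 0 \<Longrightarrow> I \<subseteq> A \<Longrightarrow> q I = 0"
begin

text \<open>A choice of coordinates for elements of the span. Independence makes it unique on
  subsets of \<open>A\<close>, the only places where \<open>conjugate\<close> reads it.\<close>

definition crd :: "real \<Rightarrow> 'i set \<Rightarrow> real" where
  "crd x = (SOME q. (\<forall>I. q I \<in> \<rat>) \<and> x = (\<Sum>I\<in>Pow A. q I * rad d I))"

text \<open>The automorphism that reverses the sign of exactly those roots whose index lies in
  \<open>J\<close>.\<close>

definition conjugate :: "'i set \<Rightarrow> real \<Rightarrow> real" where
  "conjugate J x = (\<Sum>I\<in>Pow A. of_int (sg I J) * crd x I * rad d I)"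

lemma rad_nonzero: "I \<subseteq> A \<Longrightarrow> rad d I \<noteq> 0"
proof
  assume I: "I \<subseteq> A" "rad d I = 0"
  hence "(\<Sum>H\<in>Pow A. (if H = I then 1 else 0) * rad d H) = 0"
    using fin by (intro sum.neutral) auto
  hence "(if I = I then 1 else 0 :: real) = 0"
    by (rule independent[OF _ _ I(1), rotated]) simp
  thus False by simp
qed

lemma conjugate_sum:
  assumes "\<And>I. q I \<in> \<rat>"
  shows "conjugate J (\<Sum>I\<in>Pow A. q I * rad d I) = (\<Sum>I\<in>Pow A. of_int (sg I J) * q I * rad d I)"
proof -
  let ?x = "\<Sum>I\<in>Pow A. q I * rad d I"
  have "\<exists>r. (\<forall>I. r I \<in> \<rat>) \<and> ?x = (\<Sum>I\<in>Pow A. r I * rad d I)"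
    using assms by blast
  hence c: "(\<forall>I. crd ?x I \<in> \<rat>) \<and> ?x = (\<Sum>I\<in>Pow A. crd ?x I * rad d I)"
    unfolding crd_def by (rule someI_ex)
  have "crd ?x I = q I" if "I \<subseteq> A" for I
  proof -
    have "(\<Sum>I\<in>Pow A. (crd ?x I - q I) * rad d I) = 0"
      using c by (simp add: left_diff_distrib sum_subtractf)
    from independent[OF _ this that] show ?thesis using c assms by simp
  qed
  thus ?thesis unfolding conjugate_def by (intro sum.cong) auto
qed

lemma conjugate_base:
  assumes "I \<subseteq> A" "q \<in> \<rat>"
  shows "conjugate J (q * rad d I) = of_int (sg I J) * q * rad d I"
proof -
  have "q * rad d I = (\<Sum>H\<in>Pow A. (if H = I then q else 0) * rad d H)"
    using assms fin by (simp add: if_distrib[of "\<lambda>x. x * _"] cong: if_cong)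
  also have "conjugate J \<dots> = (\<Sum>H\<in>Pow A. of_int (sg H J) * (if H = I then q else 0) * rad d H)"
    using assms(2) by (intro conjugate_sum) auto
  also have "\<dots> = (\<Sum>H\<in>Pow A. if H = I then of_int (sg I J) * q * rad d I else 0)"
    by (intro sum.cong) auto
  also have "\<dots> = of_int (sg I J) * q * rad d I"
    using assms fin by simp
  finally show ?thesis .
qed

lemma conjugate_in: "conjugate J x \<in> rad_span d A" if "x \<in> rad_span d A"
proof -
  obtain q where q: "\<And>I. q I \<in> \<rat>" "x = (\<Sum>I\<in>Pow A. q I * rad d I)"
    using \<open>x \<in> rad_span d A\<close> by (rule rad_spanE) blast
  show ?thesis
    unfolding q(2) conjugate_sum[OF q(1)] using q(1) by (intro rad_span_I) (simp add: Rats_mult)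
qed

lemma conjugate_add:
  assumes "x \<in> rad_span d A" "y \<in> rad_span d A"
  shows "conjugate J (x + y) = conjugate J x + conjugate J y"
proof -
  obtain q where q: "\<And>I. q I \<in> \<rat>" "x = (\<Sum>I\<in>Pow A. q I * rad d I)"
    using assms(1) by (rule rad_spanE) blast
  obtain r where r: "\<And>I. r I \<in> \<rat>" "y = (\<Sum>I\<in>Pow A. r I * rad d I)"
    using assms(2) by (rule rad_spanE) blast
  have "x + y = (\<Sum>I\<in>Pow A. (q I + r I) * rad d I)"
    by (simp add: q r distrib_right sum.distrib)
  hence "conjugate J (x + y) = (\<Sum>I\<in>Pow A. of_int (sg I J) * (q I + r I) * rad d I)"
    using q(1) r(1) by (simp only: conjugate_sum Rats_add)
  thus ?thesis
    unfolding q(2) r(2) conjugate_sum[OF q(1)] conjugate_sum[OF r(1)]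
    by (simp add: algebra_simps sum.distrib)
qed

lemma conjugate_Rats: "q \<in> \<rat> \<Longrightarrow> conjugate J q = q"
  using conjugate_base[of "{}" q J] by simp

lemma conjugate_finite_sum:
  "(\<And>i. i \<in> T \<Longrightarrow> f i \<in> rad_span d A) \<Longrightarrow> conjugate J (\<Sum>i\<in>T. f i) = (\<Sum>i\<in>T. conjugate J (f i))"
  by (induction T rule: infinite_finite_induct)
     (auto simp: conjugate_Rats conjugate_add rad_span_sum)

text \<open>By bilinearity it is enough to compare products of two radicals; these are graded by
  symmetric difference, for which \<open>sg\<close> is multiplicative.\<close>

lemma conjugate_mult:
  assumes "x \<in> rad_span d A" "y \<in> rad_span d A"
  shows "conjugate J (x * y) = conjugate J x * conjugate J y"
proof -
  obtain q where q: "\<And>I. q I \<in> \<rat>" "x = (\<Sum>I\<in>Pow A. q I * rad d I)"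
    using assms(1) by (rule rad_spanE) blast
  obtain r where r: "\<And>I. r I \<in> \<rat>" "y = (\<Sum>I\<in>Pow A. r I * rad d I)"
    using assms(2) by (rule rad_spanE) blast
  have base: "q I * r H * (rad d I * rad d H) \<in> rad_span d A"
    and conj: "conjugate J (q I * r H * (rad d I * rad d H)) =
      (of_int (sg I J) * q I * rad d I) * (of_int (sg H J) * r H * rad d H)"
    if IH: "I \<subseteq> A" "H \<subseteq> A" for I H
  proof -
    have f: "finite I" "finite H" using fin IH by (auto dest: finite_subset)
    define c where "c = real (\<Prod>i\<in>I \<inter> H. d i)"
    have m: "rad d I * rad d H = c * rad d (sym_diff I H)"
      unfolding c_def by (rule rad_mult[OF f])
    have *: "q I * r H * (rad d I * rad d H) = (q I * r H * c) * rad d (sym_diff I H)"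
      by (simp only: m mult.assoc)
    have Q: "q I * r H * c \<in> \<rat>" unfolding c_def using q(1) r(1) by (intro Rats_mult Rats_of_nat)
    show "q I * r H * (rad d I * rad d H) \<in> rad_span d A"
      unfolding * using IH Q fin by (intro rad_span_base) auto
    have "conjugate J (q I * r H * (rad d I * rad d H)) =
        of_int (sg (sym_diff I H) J) * (q I * r H * c) * rad d (sym_diff I H)"
      unfolding * using IH Q by (intro conjugate_base) auto
    also have "\<dots> = of_int (sg I J) * of_int (sg H J) * (q I * r H) * (rad d I * rad d H)"
      unfolding m sg_sym_diff_left[OF f] by (simp only: of_int_mult mult_ac)
    finally show "conjugate J (q I * r H * (rad d I * rad d H)) =
        (of_int (sg I J) * q I * rad d I) * (of_int (sg H J) * r H * rad d H)"
      by (simp only: mult_ac)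
  qed
  have "x * y = (\<Sum>I\<in>Pow A. \<Sum>H\<in>Pow A. q I * r H * (rad d I * rad d H))"
    by (simp add: q r sum_product mult_ac)
  hence "conjugate J (x * y) =
      (\<Sum>I\<in>Pow A. conjugate J (\<Sum>H\<in>Pow A. q I * r H * (rad d I * rad d H)))"
    using base by (simp only:) (intro conjugate_finite_sum rad_span_sum, auto)
  also have "\<dots> = (\<Sum>I\<in>Pow A. \<Sum>H\<in>Pow A. conjugate J (q I * r H * (rad d I * rad d H)))"
    using base by (intro sum.cong refl conjugate_finite_sum) auto
  also have "\<dots> = (\<Sum>I\<in>Pow A. \<Sum>H\<in>Pow A.
      (of_int (sg I J) * q I * rad d I) * (of_int (sg H J) * r H * rad d H))"
    using conj by (intro sum.cong refl) auto
  also have "\<dots> = conjugate J x * conjugate J y"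
    unfolding q(2) r(2) conjugate_sum[OF q(1)] conjugate_sum[OF r(1)] by (rule sum_product[symmetric])
  finally show ?thesis .
qed

lemma conjugate_conjugate:
  assumes "x \<in> rad_span d A" "J \<subseteq> A" "H \<subseteq> A"
  shows "conjugate J (conjugate H x) = conjugate (sym_diff J H) x"
proof -
  obtain q where q: "\<And>I. q I \<in> \<rat>" "x = (\<Sum>I\<in>Pow A. q I * rad d I)"
    using assms(1) by (rule rad_spanE) blast
  have f: "finite J" "finite H" using fin assms by (auto dest: finite_subset)
  have "conjugate J (conjugate H x) = (\<Sum>I\<in>Pow A. of_int (sg I J) * (of_int (sg I H) * q I) * rad d I)"
    unfolding q(2) conjugate_sum[OF q(1)] using q(1) by (intro conjugate_sum) (simp add: Rats_mult)
  also have "\<dots> = (\<Sum>I\<in>Pow A. of_int (sg I (sym_diff J H)) * q I * rad d I)"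
    unfolding sg_sym_diff_right[OF f] by (simp add: mult.assoc)
  also have "\<dots> = conjugate (sym_diff J H) x"
    unfolding q(2) by (rule conjugate_sum[OF q(1), symmetric])
  finally show ?thesis .
qed

lemma conjugate_empty: "x \<in> rad_span d A \<Longrightarrow> conjugate {} x = x"
  by (auto elim!: rad_spanE simp: conjugate_sum)

text \<open>The average of the conjugates of \<open>x\<close> is \<open>x\<close> itself, and by
  orthogonality of the signs only the coefficient at \<open>{}\<close> survives in it.\<close>

lemma conjugate_fixed:
  assumes "x \<in> rad_span d A" "\<And>J. J \<subseteq> A \<Longrightarrow> conjugate J x = x"
  shows "x \<in> \<rat>"
proof -
  obtain q where q: "\<And>I. q I \<in> \<rat>" "x = (\<Sum>I\<in>Pow A. q I * rad d I)"
    using assms(1) by (rule rad_spanE) blast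
  have "2 ^ card A * x = (\<Sum>J\<in>Pow A. conjugate J x)"
    using assms(2) fin by (simp add: card_Pow)
  also have "\<dots> = (\<Sum>I\<in>Pow A. \<Sum>J\<in>Pow A. of_int (sg J I) * (q I * rad d I))"
    unfolding q(2) conjugate_sum[OF q(1)]
    by (subst sum.swap) (simp add: sg_commute mult.assoc)
  also have "\<dots> = (\<Sum>I\<in>Pow A. of_int (\<Sum>J\<in>Pow A. sg J I) * (q I * rad d I))"
    by (simp add: sum_distrib_right)
  also have "\<dots> = (\<Sum>I\<in>Pow A. if I = {} then 2 ^ card A * q {} else 0)"
    using fin by (intro sum.cong refl) (simp add: sum_sg)
  also have "\<dots> = 2 ^ card A * q {}"
    using fin by simp
  finally show ?thesis using q(1) by simp
qed

sublocale sign_galois_field A "rad_span d A" conjugate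
proof
  show "\<exists>B. finite B \<and> B \<subseteq> rad_span d A \<and> (\<forall>b\<in>B. algebraic_int b) \<and>
      (\<forall>x\<in>rad_span d A. \<exists>q. (\<forall>b. q b \<in> \<rat>) \<and> x = (\<Sum>b\<in>B. q b * b))"
  proof (intro exI[of _ "rad d ` Pow A"] conjI ballI)
    \<comment> \<open>Coefficients are indexed here by the elements of the spanning set instead of
      by index sets, so distinct sets must give distinct radicals.\<close>
    have inj: "inj_on (rad d) (Pow A)"
    proof (rule inj_onI, rule ccontr)
      fix I H assume IH: "I \<in> Pow A" "H \<in> Pow A" "rad d I = rad d H" "I \<noteq> H"
      have "(\<Sum>L\<in>Pow A. (if L = I then 1 else if L = H then - 1 else 0) * rad d L) =
          (\<Sum>L\<in>Pow A. (if L = I then rad d I else 0) + (if L = H then - rad d H else 0))"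
        using IH(4) by (intro sum.cong) auto
      also have "\<dots> = 0"
        using IH fin by (simp add: sum.distrib)
      finally have "(if I = I then 1 else if I = H then - 1 else 0 :: real) = 0"
        by (rule independent[rotated]) (use IH(1) in auto)
      thus False by simp
    qed
    show "rad d ` Pow A \<subseteq> rad_span d A"
      using fin rad_span_base[of A _ 1 d] by auto
    fix x assume "x \<in> rad_span d A"
    then obtain q where q: "\<And>I. q I \<in> \<rat>" "x = (\<Sum>I\<in>Pow A. q I * rad d I)"
      by (rule rad_spanE) blast
    have "x = (\<Sum>b\<in>rad d ` Pow A. q (the_inv_into (Pow A) (rad d) b) * b)"
      using inj by (simp add: q(2) sum.reindex the_inv_into_f_f)
    thus "\<exists>q. (\<forall>b. q b \<in> \<rat>) \<and> x = (\<Sum>b\<in>rad d ` Pow A. q b * b)"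
      using q(1) by (intro exI[of _ "\<lambda>b. q (the_inv_into (Pow A) (rad d) b)"]) simp
  qed (use fin algebraic_int_rad in auto)
qed (use fin in \<open>simp_all add: Rats_rad_span rad_span_add rad_span_mult rad_span_inverse conjugate_in
  conjugate_add conjugate_mult conjugate_Rats conjugate_conjugate conjugate_empty conjugate_fixed\<close>)

section \<open>The Galois group as the group of sign changes\<close>

lemma conjugate_sqrt: "i \<in> A \<Longrightarrow> conjugate J (sqrt (real (d i))) = (if i \<in> J then - 1 else 1) * sqrt (real (d i))"
  using conjugate_base[of "{i}" 1 J] by (simp add: rad_def sg_singleton)

lemma inj_conjugate: "inj_on (\<lambda>J. restrict (conjugate J) (rad_span d A)) (Pow A)"
proof (rule inj_onI)
  fix J H assume JH: "J \<in> Pow A" "H \<in> Pow A"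
    "restrict (conjugate J) (rad_span d A) = restrict (conjugate H) (rad_span d A)"
  have "i \<in> J \<longleftrightarrow> i \<in> H" if "i \<in> A" for i
  proof -
    have s: "sqrt (real (d i)) \<in> rad_span d A"
      using that fin by (intro sqrt_in_rad_span)
    have "sqrt (real (d i)) \<noteq> 0"
      using rad_nonzero[of "{i}"] that by (simp add: rad_def)
    moreover have "conjugate J (sqrt (real (d i))) = conjugate H (sqrt (real (d i)))"
      using fun_cong[OF JH(3), of "sqrt (real (d i))"] s by simp
    ultimately show ?thesis
      using that by (auto simp: conjugate_sqrt split: if_splits)
  qed
  thus "J = H" using JH by auto
qed

text \<open>An automorphism fixes \<open>real (d i)\<close>, so it maps each root to itself or to
  its negative, and the set of indices where the sign changes determines it. The restriction matches
  the convention that automorphisms are undefined outside the field.\<close>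

lemma galois_group_eq: "galois_group (rad_span d A) = (\<lambda>J. restrict (conjugate J) (rad_span d A)) ` Pow A"
proof
  let ?K = "rad_span d A"
  show "(\<lambda>J. restrict (conjugate J) ?K) ` Pow A \<subseteq> galois_group ?K"
  proof
    fix g assume "g \<in> (\<lambda>J. restrict (conjugate J) ?K) ` Pow A"
    then obtain J where J: "J \<subseteq> A" "g = restrict (conjugate J) ?K" by auto
    \<comment> \<open>A sign change is an involution, so \<open>g\<close> is its own
      inverse.\<close>
    have "bij_betw g ?K ?K"
      by (rule bij_betw_byWitness[of _ g]) (use J in \<open>auto simp: phi_involution phi_K\<close>)
    moreover have "g \<in> Ring.ring_hom (real_ring\<lparr>carrier := ?K\<rparr>) (real_ring\<lparr>carrier := ?K\<rparr>)"
      by (rule ring_hom_memI) (use J in \<open>simp_all add: phi_K phi_add phi_mult add_K mult_K\<close>)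
    moreover have "\<forall>q\<in>\<rat>. g q = q"
      using J Rats_K by (auto simp: phi_Rats)
    ultimately show "g \<in> galois_group ?K"
      using J(2) by (simp add: galois_group_def ring_iso_def)
  qed
  show "galois_group ?K \<subseteq> (\<lambda>J. restrict (conjugate J) ?K) ` Pow A"
  proof
    fix g assume g: "g \<in> galois_group ?K"
    hence hom: "g \<in> Ring.ring_hom (real_ring\<lparr>carrier := ?K\<rparr>) (real_ring\<lparr>carrier := ?K\<rparr>)"
      and ext: "g \<in> extensional ?K" and rat: "\<And>q. q \<in> \<rat> \<Longrightarrow> g q = q"
      by (auto simp: galois_group_def ring_iso_def)
    have g_add: "g (x + y) = g x + g y" if "x \<in> ?K" "y \<in> ?K" for x y
      using ring_hom_add[OF hom, of x y] that by simp
    have g_mult: "g (x * y) = g x * g y" if "x \<in> ?K" "y \<in> ?K" for x y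
      using ring_hom_mult[OF hom, of x y] that by simp
    have g_sum: "g (\<Sum>i\<in>T. f i) = (\<Sum>i\<in>T. g (f i))" if "\<And>i. i \<in> T \<Longrightarrow> f i \<in> ?K"
      for T :: "'i set set" and f
      using that by (induction T rule: infinite_finite_induct) (auto simp: rat g_add sum_K)
    have s: "sqrt (real (d i)) \<in> ?K" if "i \<in> A" for i
      using that fin by (intro sqrt_in_rad_span)
    define J where "J = {i \<in> A. g (sqrt (real (d i))) \<noteq> sqrt (real (d i))}"
    have g_sqrt: "g (sqrt (real (d i))) = (if i \<in> J then - 1 else 1) * sqrt (real (d i))" if "i \<in> A" for i
    proof -
      have "g (sqrt (real (d i))) * g (sqrt (real (d i))) = g (real (d i))"
        using g_mult[OF s[OF that] s[OF that]] by simp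
      also have "\<dots> = sqrt (real (d i)) * sqrt (real (d i))"
        by (simp add: rat)
      finally have "g (sqrt (real (d i))) = sqrt (real (d i)) \<or> g (sqrt (real (d i))) = - sqrt (real (d i))"
        by (simp only: square_eq_iff)
      thus ?thesis using that by (auto simp: J_def)
    qed
    have rad_K: "rad d I \<in> ?K" if "I \<subseteq> A" for I
      using rad_span_base[OF fin that, of 1 d] by simp
    have g_rad: "g (rad d I) = of_int (sg I J) * rad d I" if "I \<subseteq> A" for I
      using finite_subset[OF that fin] that
    proof (induction I rule: finite_induct)
      case (insert i I)
      have "sg (insert i I) J = sg {i} J * sg I J"
        using sg_sym_diff_left[of "{i}" I J] insert.hyps by (simp add: insert_Diff_if)
      thus ?case
        using insert by (simp add: rad_insert g_mult s rad_K g_sqrt sg_singleton)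
    qed (simp add: rat)
    have "g x = conjugate J x" if "x \<in> ?K" for x
    proof -
      obtain q where q: "\<And>I. q I \<in> \<rat>" "x = (\<Sum>I\<in>Pow A. q I * rad d I)"
        using \<open>x \<in> ?K\<close> by (rule rad_spanE) blast
      have qK: "q I \<in> ?K" for I using q(1) Rats_K by blast
      have "g x = (\<Sum>I\<in>Pow A. g (q I * rad d I))"
        unfolding q(2) using qK rad_K by (intro g_sum mult_K) auto
      also have "\<dots> = (\<Sum>I\<in>Pow A. of_int (sg I J) * q I * rad d I)"
        using qK q(1) by (intro sum.cong refl) (simp add: g_mult rad_K rat g_rad)
      also have "\<dots> = conjugate J x"
        unfolding q(2) by (rule conjugate_sum[OF q(1), symmetric])
      finally show ?thesis .
    qed
    hence "g = restrict (conjugate J) ?K"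
      using ext by (intro extensionalityI[of _ ?K]) auto
    moreover have "J \<subseteq> A" by (auto simp: J_def)
    ultimately show "g \<in> (\<lambda>J. restrict (conjugate J) ?K) ` Pow A" by blast
  qed
qed

section \<open>Norm, unit group and index in terms of sign changes\<close>

lemma prod_galois_group:
  "(\<Prod>g\<in>galois_group (rad_span d A). F g) = (\<Prod>J\<in>Pow A. F (restrict (conjugate J) (rad_span d A)))"
  unfolding galois_group_eq by (simp add: prod.reindex[OF inj_conjugate])

lemma galois_norm_eq: "x \<in> rad_span d A \<Longrightarrow> galois_norm (rad_span d A) x = (\<Prod>J\<in>Pow A. conjugate J x)"
  by (simp add: galois_norm_def prod_galois_group)

lemma galois_span_eq:
  assumes "x \<in> rad_span d A"
  shows "galois_span (rad_span d A) x = conj_powers x"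
proof -
  let ?r = "\<lambda>J. restrict (conjugate J) (rad_span d A)"
  have "\<exists>c'. (\<Prod>J\<in>Pow A. conjugate J x powi c J) = (\<Prod>J\<in>Pow A. conjugate J x powi c' (?r J))"
    for c :: "'i set \<Rightarrow> int"
    by (intro exI[of _ "\<lambda>g. c (the_inv_into (Pow A) ?r g)"] prod.cong refl)
       (simp add: the_inv_into_f_f[OF inj_conjugate])
  thus ?thesis
    using assms by (fastforce simp: galois_span_def conj_powers_def prod_galois_group)
qed

lemma carrier_units: "carrier (units_of (ring_of_integers (rad_span d A))) = unit_set"
proof (rule Set.set_eqI, rule iffI)
  fix x assume "x \<in> carrier (units_of (ring_of_integers (rad_span d A)))"
  then obtain y where x: "x \<in> rad_span d A" "algebraic_int x" and y: "algebraic_int y" "x * y = 1"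
    by (auto simp: units_of_def Units_def ring_of_integers_def)
  have "inverse x = y" using y(2) by (rule inverse_unique)
  thus "x \<in> unit_set" using x y by (auto simp: unit_set_def)
next
  fix x assume "x \<in> unit_set"
  thus "x \<in> carrier (units_of (ring_of_integers (rad_span d A)))"
    by (auto simp: units_of_def Units_def ring_of_integers_def unit_set_def inverse_K
        intro!: exI[of _ "inverse x"])
qed

lemma odd_index_conj_powers:
  assumes \<epsilon>: "\<epsilon> \<in> unit_set" "(\<Prod>J\<in>Pow A. conjugate J \<epsilon>) = - 1"
  defines "G \<equiv> units_of (ring_of_integers (rad_span d A))"
  shows "finite (rcosets\<^bsub>G\<^esub> (conj_powers \<epsilon>)) \<and> odd (card (rcosets\<^bsub>G\<^esub> (conj_powers \<epsilon>)))"
proof -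
  note \<epsilon>K = unit_setD(1,2)[OF \<epsilon>(1)]
  have carrier: "carrier G = unit_set"
    unfolding G_def by (rule carrier_units)
  have ops [simp]: "x \<otimes>\<^bsub>G\<^esub> y = x * y" "\<one>\<^bsub>G\<^esub> = 1" for x y
    by (simp_all add: G_def units_of_def ring_of_integers_def)
  interpret G: comm_group G
  proof (rule comm_groupI)
    show "\<exists>y\<in>carrier G. y \<otimes>\<^bsub>G\<^esub> x = \<one>\<^bsub>G\<^esub>" if "x \<in> carrier G" for x
      using that unit_setD(2) by (auto simp: carrier intro!: bexI[of _ "inverse x"] unit_set_inverse)
  qed (auto simp: carrier unit_set_mult unit_set_one mult_ac)
  have inv: "inv\<^bsub>G\<^esub> x = inverse x" if "x \<in> unit_set" for x
    using that unit_setD(2)[OF that]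
    by (intro G.inv_equality) (auto simp: carrier unit_set_inverse)
  have S: "subgroup (conj_powers \<epsilon>) G"
  proof (rule G.subgroupI)
    show "inv\<^bsub>G\<^esub> x \<in> conj_powers \<epsilon>" if "x \<in> conj_powers \<epsilon>" for x
      using that inv conj_powers_units[OF \<epsilon>(1)] conj_powers_inverse by auto
    show "conj_powers \<epsilon> \<noteq> {}" using conj_powers_one by blast
  qed (use conj_powers_units[OF \<epsilon>(1)] conj_powers_mult[OF \<epsilon>K] in \<open>auto simp: carrier\<close>)
  obtain C where C: "\<And>u. u \<in> unit_set \<Longrightarrow> \<exists>w\<in>conj_powers \<epsilon>. \<forall>H\<subseteq>A. \<bar>conjugate H (u * w)\<bar> \<le> C"
    using ex_bounded_representatives[OF \<epsilon>] by blast
  have fin: "finite (rcosets\<^bsub>G\<^esub> (conj_powers \<epsilon>))"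
  proof (rule G.finite_rcosets_if_finite_representatives[OF S finite_bounded_conjugates[of C]])
    fix u assume "u \<in> carrier G"
    hence u: "u \<in> unit_set" by (simp add: carrier)
    obtain w where w: "w \<in> conj_powers \<epsilon>" "\<forall>H\<subseteq>A. \<bar>conjugate H (u * w)\<bar> \<le> C"
      using C[OF u] by blast
    have "u * w \<in> unit_set"
      using u w(1) conj_powers_units[OF \<epsilon>(1)] by (auto intro: unit_set_mult)
    thus "\<exists>w\<in>conj_powers \<epsilon>. u \<otimes>\<^bsub>G\<^esub> w \<in>
        {x \<in> rad_span d A. algebraic_int x \<and> (\<forall>J\<subseteq>A. \<bar>conjugate J x\<bar> \<le> C)}"
      using w unit_setD by (intro bexI[of _ w]) auto
  qed
  moreover have "odd (card (rcosets\<^bsub>G\<^esub> (conj_powers \<epsilon>)))"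
    by (rule G.odd_card_rcosets[OF S fin])
       (use conj_powers_square_root[OF \<epsilon>] in \<open>auto simp: carrier\<close>)
  ultimately show ?thesis ..
qed

end

theorem theorem5p6:
  fixes K :: "real set" and \<epsilon> :: real
  assumes "totally_real_multiquadratic K"
    and "\<epsilon> \<in> carrier (units_of (ring_of_integers K))"
    and "galois_norm K \<epsilon> = -1"
  shows "finite (rcosets\<^bsub>units_of (ring_of_integers K)\<^esub> (galois_span K \<epsilon>)) \<and>
    gcd (card (rcosets\<^bsub>units_of (ring_of_integers K)\<^esub> (galois_span K \<epsilon>))) 2 = 1"
proof -
  obtain m :: nat and d :: "nat \<Rightarrow> nat"
    where "K = generate_field real_ring ((\<lambda>i. sqrt (real (d i))) ` {1..m})"
      and dim: "ring.dimension real_ring (2 ^ m) \<rat> K"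
    using assms(1) unfolding totally_real_multiquadratic_def by blast
  hence K: "K = rad_span d {1..m}"
    by (simp only: generate_field_sqrt finite_atLeastAtMost)
  \<comment> \<open>The degree \<open>2 ^ m\<close> of \<open>K\<close> enters here, as linear
    independence of the radicals.\<close>
  interpret independent_radicals "{1..m}" d
  proof
    fix q I
    assume "\<And>I. q I \<in> \<rat>" "(\<Sum>I\<in>Pow {1..m}. q I * rad d I) = 0" "I \<subseteq> {1..m}"
    thus "q I = 0"
      using dim unfolding K by (intro rad_independent[of "{1..m}" d q I]) auto
  qed simp
  have \<epsilon>: "\<epsilon> \<in> unit_set"
    using assms(2) by (simp only: K carrier_units)
  note \<epsilon>K = unit_setD(1)[OF \<epsilon>]
  have "(\<Prod>J\<in>Pow {1..m}. conjugate J \<epsilon>) = - 1"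
    using assms(3) unfolding K galois_norm_eq[OF \<epsilon>K] .
  from odd_index_conj_powers[OF \<epsilon> this] show ?thesis
    unfolding K galois_span_eq[OF \<epsilon>K] by (simp add: coprime_iff_gcd_eq_1[symmetric])
qed

end
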